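(* Let $(M,g,\omega,J)$ be an almost-Hermitian four-manifold and let $\lambda_1\le\lambda_2\le\lambda_3$ be the eigenvalues (at each point) of $W^{-}$. Then at each point \[H_{omax}=\frac{s+3s^{*}}{24}+\frac{\lambda_3}{2},\qquad H_{omin}=\frac{s+3s^{*}}{24}+\frac{\lambda_1}{2},\] where $H_{omax}$ (resp. $H_{omin}$) is the maximum (resp. minimum) of the orthogonal holomorphic sectional curvature, $s$ is the scalar curvature and $s^{*}=2R(\omega,\omega)$.
   Context: An almost-Hermitian four-manifold is a Riemannian four-manifold with an almost complex structure $J$ satisfying $g(JX,JY)=g(X,Y)$; its fundamental 2-form is $\omega(X,Y):=g(JX,Y)$, and $M$ carries the orientation induced by $J$, for which $\omega$ is self-dual with $|\omega|=\sqrt2$. Curvature: $R(X,Y)Z:=\nabla_X\nabla_YZ-\nabla_Y\nabla_XZ-\nabla_{[X,Y]}Z$ and $R(X\wedge Y,V\wedge W):=g(R(X,Y)W,V)$, extended to a symmetric bilinear form on $\Lambda^2$ (forms and vectors identified by $g$, $|e_1\wedge e_2|=1$ for orthonormal $e_1,e_2$). The corresponding curvature operator has diagonal blocks $W^{+}+\frac{s}{12}I$ on $\Lambda^+$ and $W^{-}+\frac{s}{12}I$ on $\Lambda^-$, with $W^\pm$ trace-free. In an orthonormal basis $\{e_1,e_2=Je_1,e_3,e_4=Je_3\}$, $s^*=2R_{1212}+2R_{3434}+4R_{1234}$, where $R_{ijkl}=R(e_i\wedge e_j,e_k\wedge e_l)$. For an orthonormal basis $\{X,JX,Y,JY\}$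 of $T_pM$, the orthogonal holomorphic sectional curvature is \[H_{ohol}(X,Y):=\tfrac12\big(R(X\wedge JX,X\wedge JX)+R(Y\wedge JY,Y\wedge JY)\big).\] The maximum and minimum at $p$ are taken over all such orthonormal bases of $T_pM$. *)

theory Defs
  imports "HOL-Analysis.Analysis"
begin

section \<open>Smooth four-manifolds\<close>

primrec Ck_on :: "nat \<Rightarrow> ('a::euclidean_space \<Rightarrow> 'b::real_normed_vector) \<Rightarrow> 'a set \<Rightarrow> bool" where
  "Ck_on 0 f S \<longleftrightarrow> continuous_on S f"
| "Ck_on (Suc k) f S \<longleftrightarrow>
     f differentiable_on S \<and> (\<forall>v. Ck_on k (\<lambda>x. frechet_derivative f (at x) v) S)"

text \<open>Only used for open \<open>S\<close>.\<close>
definition smooth_on :: "('a::euclidean_space \<Rightarrow> 'b::real_normed_vector) \<Rightarrow> 'a set \<Rightarrow> bool" where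
  "smooth_on f S \<longleftrightarrow> (\<forall>k. Ck_on k f S)"

text \<open>A chart is a pair of its domain and its coordinate map.\<close>
type_synonym 'm chart = "'m set \<times> ('m \<Rightarrow> real ^ 4)"

abbreviation chart_image :: "'m chart \<Rightarrow> (real ^ 4) set" where
  "chart_image c \<equiv> snd c ` fst c"

definition transition :: "'m chart \<Rightarrow> 'm chart \<Rightarrow> real ^ 4 \<Rightarrow> real ^ 4" where
  "transition c c' = snd c' \<circ> inv_into (fst c) (snd c)"

definition second_countable_space :: "'m topology \<Rightarrow> bool" where
  "second_countable_space X \<longleftrightarrow>
     (\<exists>B. countable B \<and> openin X = arbitrary union_of (\<lambda>b. b \<in> B))"

definition smooth_four_manifold :: "'m topology \<Rightarrow> 'm chart set \<Rightarrow> bool" where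
  "smooth_four_manifold X A \<longleftrightarrow>
     Hausdorff_space X \<and> second_countable_space X \<and>
     \<Union> (fst ` A) = topspace X \<and>
     (\<forall>c\<in>A. openin X (fst c) \<and> open (chart_image c) \<and>
        homeomorphic_map (subtopology X (fst c)) (top_of_set (chart_image c)) (snd c)) \<and>
     (\<forall>c\<in>A. \<forall>c'\<in>A. smooth_on (transition c c') (snd c ` (fst c \<inter> fst c')))"

section \<open>Almost-Hermitian structures\<close>

text \<open>
  A tangent vector at \<open>p\<close> is given by its components with respect to the coordinate frame
  of a chart around \<open>p\<close>. A tensor field is a family of component functions, one for each chart of
  the atlas and defined on the image of that chart, which obeys the tensor transformation rule.
  The metric has the Gram matrix \<open>g c x\<close>, and the almost complex structure has the matrix \<open>J c x\<close>,
  acting on component columns.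
\<close>

definition metric :: "(real ^ 4 \<Rightarrow> real ^ 4 ^ 4) \<Rightarrow> real ^ 4 \<Rightarrow> real ^ 4 \<Rightarrow> real ^ 4 \<Rightarrow> real" where
  "metric G x u v = u \<bullet> (G x *v v)"

definition transition_matrix :: "'m chart \<Rightarrow> 'm chart \<Rightarrow> 'm \<Rightarrow> real ^ 4 ^ 4" where
  "transition_matrix c c' p = matrix (frechet_derivative (transition c c') (at (snd c p)))"

definition riemannian_metric_on :: "'m chart set \<Rightarrow> ('m chart \<Rightarrow> real ^ 4 \<Rightarrow> real ^ 4 ^ 4) \<Rightarrow> bool" where
  "riemannian_metric_on A g \<longleftrightarrow>
     (\<forall>c\<in>A. smooth_on (g c) (chart_image c)) \<and>
     (\<forall>c\<in>A. \<forall>x\<in>chart_image c.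
        (\<forall>u v. metric (g c) x u v = metric (g c) x v u) \<and>
        (\<forall>v. v \<noteq> 0 \<longrightarrow> metric (g c) x v v > 0)) \<and>
     (\<forall>c\<in>A. \<forall>c'\<in>A. \<forall>p\<in>fst c \<inter> fst c'. \<forall>u v.
        metric (g c) (snd c p) u v =
        metric (g c') (snd c' p) (transition_matrix c c' p *v u) (transition_matrix c c' p *v v))"

definition almost_complex_structure_on :: "'m chart set \<Rightarrow> ('m chart \<Rightarrow> real ^ 4 \<Rightarrow> real ^ 4 ^ 4) \<Rightarrow> bool" where
  "almost_complex_structure_on A J \<longleftrightarrow>
     (\<forall>c\<in>A. smooth_on (J c) (chart_image c)) \<and>
     (\<forall>c\<in>A. \<forall>x\<in>chart_image c. \<forall>v. J c x *v (J c x *v v) = - v) \<and>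
     (\<forall>c\<in>A. \<forall>c'\<in>A. \<forall>p\<in>fst c \<inter> fst c'. \<forall>v.
        transition_matrix c c' p *v (J c (snd c p) *v v) =
        J c' (snd c' p) *v (transition_matrix c c' p *v v))"

definition almost_hermitian_four_manifold ::
  "'m topology \<Rightarrow> 'm chart set \<Rightarrow> ('m chart \<Rightarrow> real ^ 4 \<Rightarrow> real ^ 4 ^ 4) \<Rightarrow>
   ('m chart \<Rightarrow> real ^ 4 \<Rightarrow> real ^ 4 ^ 4) \<Rightarrow> bool" where
  "almost_hermitian_four_manifold X A g J \<longleftrightarrow>
     smooth_four_manifold X A \<and> riemannian_metric_on A g \<and> almost_complex_structure_on A J \<and>
     (\<forall>c\<in>A. \<forall>x\<in>chart_image c. \<forall>u v.
        metric (g c) x (J c x *v u) (J c x *v v) = metric (g c) x u v)"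

section \<open>Levi-Civita connection and curvature in a chart\<close>

text \<open>From here on, \<open>G\<close> and \<open>J\<close> are the component functions of the metric and of the almost
  complex structure in one chart, and \<open>x\<close> is a point of the image of that chart.\<close>

abbreviation ptl :: "4 \<Rightarrow> (real ^ 4 \<Rightarrow> real) \<Rightarrow> real ^ 4 \<Rightarrow> real" where
  "ptl i f x \<equiv> frechet_derivative f (at x) (axis i 1)"

text \<open>The Christoffel symbol with upper index \<open>k\<close> and lower indices \<open>i\<close>, \<open>j\<close>.\<close>
definition christoffel :: "(real ^ 4 \<Rightarrow> real ^ 4 ^ 4) \<Rightarrow> real ^ 4 \<Rightarrow> 4 \<Rightarrow> 4 \<Rightarrow> 4 \<Rightarrow> real" where
  "christoffel G x k i j = (1/2) * (\<Sum>l\<in>UNIV. matrix_inv (G x) $ k $ l *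
     (ptl i (\<lambda>y. G y $ j $ l) x + ptl j (\<lambda>y. G y $ i $ l) x - ptl l (\<lambda>y. G y $ i $ j) x))"

definition nabla :: "(real ^ 4 \<Rightarrow> real ^ 4 ^ 4) \<Rightarrow> (real ^ 4 \<Rightarrow> real ^ 4) \<Rightarrow> (real ^ 4 \<Rightarrow> real ^ 4) \<Rightarrow>
    real ^ 4 \<Rightarrow> real ^ 4" where
  "nabla G X Y = (\<lambda>x. frechet_derivative Y (at x) (X x) +
     (\<chi> k. \<Sum>i\<in>UNIV. \<Sum>j\<in>UNIV. christoffel G x k i j * X x $ i * Y x $ j))"

definition lie_bracket :: "(real ^ 4 \<Rightarrow> real ^ 4) \<Rightarrow> (real ^ 4 \<Rightarrow> real ^ 4) \<Rightarrow> real ^ 4 \<Rightarrow> real ^ 4" where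
  "lie_bracket X Y = (\<lambda>x. frechet_derivative Y (at x) (X x) - frechet_derivative X (at x) (Y x))"

definition curvature_field :: "(real ^ 4 \<Rightarrow> real ^ 4 ^ 4) \<Rightarrow> (real ^ 4 \<Rightarrow> real ^ 4) \<Rightarrow>
    (real ^ 4 \<Rightarrow> real ^ 4) \<Rightarrow> (real ^ 4 \<Rightarrow> real ^ 4) \<Rightarrow> real ^ 4 \<Rightarrow> real ^ 4" where
  "curvature_field G X Y Z = (\<lambda>x. nabla G X (nabla G Y Z) x - nabla G Y (nabla G X Z) x -
     nabla G (lie_bracket X Y) Z x)"

text \<open>The curvature is tensorial, so its value on vectors at \<open>x\<close> can be computed from the
  extensions with constant components.\<close>
definition curvature :: "(real ^ 4 \<Rightarrow> real ^ 4 ^ 4) \<Rightarrow> real ^ 4 \<Rightarrow> real ^ 4 \<Rightarrow> real ^ 4 \<Rightarrow> real ^ 4 \<Rightarrow>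
    real ^ 4" where
  "curvature G x u v w = curvature_field G (\<lambda>_. u) (\<lambda>_. v) (\<lambda>_. w) x"

text \<open>The sign and the order of the last two arguments are chosen so that \<open>riem G x u v u v\<close> is the
  sectional curvature of the plane spanned by orthonormal \<open>u\<close>, \<open>v\<close>.\<close>
definition riem :: "(real ^ 4 \<Rightarrow> real ^ 4 ^ 4) \<Rightarrow> real ^ 4 \<Rightarrow> real ^ 4 \<Rightarrow> real ^ 4 \<Rightarrow> real ^ 4 \<Rightarrow> real ^ 4 \<Rightarrow>
    real" where
  "riem G x X Y V W = metric G x (curvature G x X Y W) V"

definition ricci :: "(real ^ 4 \<Rightarrow> real ^ 4 ^ 4) \<Rightarrow> real ^ 4 \<Rightarrow> real ^ 4 \<Rightarrow> real ^ 4 \<Rightarrow> real" where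
  "ricci G x Y Z = (\<Sum>k\<in>UNIV. curvature G x (axis k 1) Y Z $ k)"

definition scalar_curvature :: "(real ^ 4 \<Rightarrow> real ^ 4 ^ 4) \<Rightarrow> real ^ 4 \<Rightarrow> real" where
  "scalar_curvature G x =
     (\<Sum>i\<in>UNIV. \<Sum>j\<in>UNIV. matrix_inv (G x) $ i $ j * ricci G x (axis i 1) (axis j 1))"

text \<open>Kulkarni--Nomizu product, with the same order of arguments as \<^const>\<open>riem\<close>.\<close>
definition kulkarni_nomizu :: "(real ^ 4 \<Rightarrow> real ^ 4 \<Rightarrow> real) \<Rightarrow> (real ^ 4 \<Rightarrow> real ^ 4 \<Rightarrow> real) \<Rightarrow>
    real ^ 4 \<Rightarrow> real ^ 4 \<Rightarrow> real ^ 4 \<Rightarrow> real ^ 4 \<Rightarrow> real" where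
  "kulkarni_nomizu h k X Y V W = h X V * k Y W + h Y W * k X V - h X W * k Y V - h Y V * k X W"

text \<open>In dimension \<open>n\<close> the coefficients are \<open>1 / (n - 2)\<close> and \<open>s / (2 (n - 1) (n - 2))\<close>;
  here \<open>n = 4\<close>.\<close>
definition weyl :: "(real ^ 4 \<Rightarrow> real ^ 4 ^ 4) \<Rightarrow> real ^ 4 \<Rightarrow> real ^ 4 \<Rightarrow> real ^ 4 \<Rightarrow> real ^ 4 \<Rightarrow> real ^ 4 \<Rightarrow>
    real" where
  "weyl G x X Y V W = riem G x X Y V W
     - (1/2) * kulkarni_nomizu (ricci G x) (metric G x) X Y V W
     + (scalar_curvature G x / 12) * kulkarni_nomizu (metric G x) (metric G x) X Y V W"

section \<open>Bivectors and self-duality\<close>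

text \<open>Elements of \<open>\<Lambda>\<^sup>2\<close> are represented by their skew-symmetric matrices of contravariant
  components, two-forms being identified with bivectors by means of the metric.\<close>

definition bivectors :: "(real ^ 4 ^ 4) set" where
  "bivectors = {B. transpose B = - B}"

definition wedge :: "real ^ 4 \<Rightarrow> real ^ 4 \<Rightarrow> real ^ 4 ^ 4" where
  "wedge u v = (\<chi> i j. u $ i * v $ j - u $ j * v $ i)"

text \<open>The bilinear extension of \<open>T X Y V W\<close> to \<open>\<Lambda>\<^sup>2\<close>. A bivector \<open>B\<close> is half the sum of
  \<open>B $ i $ j\<close> times the wedge of the coordinate vectors \<open>i\<close>, \<open>j\<close>, over all \<open>i\<close>, \<open>j\<close>.\<close>
definition bivector_form :: "(real ^ 4 \<Rightarrow> real ^ 4 \<Rightarrow> real ^ 4 \<Rightarrow> real ^ 4 \<Rightarrow> real) \<Rightarrow>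
    real ^ 4 ^ 4 \<Rightarrow> real ^ 4 ^ 4 \<Rightarrow> real" where
  "bivector_form T B C = (1/4) * (\<Sum>i\<in>UNIV. \<Sum>j\<in>UNIV. \<Sum>k\<in>UNIV. \<Sum>l\<in>UNIV.
     B $ i $ j * C $ k $ l * T (axis i 1) (axis j 1) (axis k 1) (axis l 1))"

definition lower :: "(real ^ 4 \<Rightarrow> real ^ 4 ^ 4) \<Rightarrow> real ^ 4 \<Rightarrow> real ^ 4 ^ 4 \<Rightarrow> real ^ 4 ^ 4" where
  "lower G x B = G x ** B ** G x"

definition raise :: "(real ^ 4 \<Rightarrow> real ^ 4 ^ 4) \<Rightarrow> real ^ 4 \<Rightarrow> real ^ 4 ^ 4 \<Rightarrow> real ^ 4 ^ 4" where
  "raise G x B = matrix_inv (G x) ** B ** matrix_inv (G x)"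

text \<open>The endomorphism of \<open>\<Lambda>\<^sup>2\<close> that corresponds to \<^term>\<open>bivector_form T\<close> under the inner product
  for which the wedge of two orthonormal vectors has length \<open>1\<close>.\<close>
definition bivector_operator :: "(real ^ 4 \<Rightarrow> real ^ 4 ^ 4) \<Rightarrow> real ^ 4 \<Rightarrow>
    (real ^ 4 \<Rightarrow> real ^ 4 \<Rightarrow> real ^ 4 \<Rightarrow> real ^ 4 \<Rightarrow> real) \<Rightarrow> real ^ 4 ^ 4 \<Rightarrow> real ^ 4 ^ 4" where
  "bivector_operator G x T B = raise G x (\<chi> a b. (1/2) * (\<Sum>k\<in>UNIV. \<Sum>l\<in>UNIV.
     B $ k $ l * T (axis k 1) (axis l 1) (axis a 1) (axis b 1)))"

definition frame :: "real ^ 4 \<Rightarrow> real ^ 4 \<Rightarrow> real ^ 4 \<Rightarrow> real ^ 4 \<Rightarrow> real ^ 4 ^ 4" where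
  "frame a b c d = vector [a, b, c, d]"

text \<open>The sign of the coordinate frame with respect to the orientation for which the bases
  \<open>(u, J u, v, J v)\<close> are positive.\<close>
definition orientation_sign :: "(real ^ 4 \<Rightarrow> real ^ 4 ^ 4) \<Rightarrow> real ^ 4 \<Rightarrow> real" where
  "orientation_sign J x =
     (if \<exists>u v. det (frame u (J x *v u) v (J x *v v)) > 0 then 1 else -1)"

definition levi_civita_symbol :: "4 \<Rightarrow> 4 \<Rightarrow> 4 \<Rightarrow> 4 \<Rightarrow> real" where
  "levi_civita_symbol i j k l = det (frame (axis i 1) (axis j 1) (axis k 1) (axis l 1))"

definition hodge_star :: "(real ^ 4 \<Rightarrow> real ^ 4 ^ 4) \<Rightarrow> (real ^ 4 \<Rightarrow> real ^ 4 ^ 4) \<Rightarrow> real ^ 4 \<Rightarrow>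
    real ^ 4 ^ 4 \<Rightarrow> real ^ 4 ^ 4" where
  "hodge_star G J x B = (\<chi> i j. orientation_sign J x / (2 * sqrt (det (G x))) *
     (\<Sum>k\<in>UNIV. \<Sum>l\<in>UNIV. levi_civita_symbol i j k l * lower G x B $ k $ l))"

definition Lambda_minus :: "(real ^ 4 \<Rightarrow> real ^ 4 ^ 4) \<Rightarrow> (real ^ 4 \<Rightarrow> real ^ 4 ^ 4) \<Rightarrow> real ^ 4 \<Rightarrow>
    (real ^ 4 ^ 4) set" where
  "Lambda_minus G J x = {B \<in> bivectors. hodge_star G J x B = - B}"

text \<open>The anti-self-dual block of the Weyl operator, to be applied to elements of
  \<^const>\<open>Lambda_minus\<close>.\<close>
definition W_minus :: "(real ^ 4 \<Rightarrow> real ^ 4 ^ 4) \<Rightarrow> (real ^ 4 \<Rightarrow> real ^ 4 ^ 4) \<Rightarrow> real ^ 4 \<Rightarrow>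
    real ^ 4 ^ 4 \<Rightarrow> real ^ 4 ^ 4" where
  "W_minus G J x B = (let C = bivector_operator G x (weyl G x) B
     in (1/2) *\<^sub>R (C - hodge_star G J x C))"

text \<open>The list \<open>ls\<close> consists of the real eigenvalues of \<open>T\<close> on the subspace \<open>V\<close>, each repeated
  according to the dimension of its eigenspace. For a self-adjoint \<open>T\<close> this is also the algebraic
  multiplicity.\<close>
definition eigenvalues_on :: "('v::euclidean_space) set \<Rightarrow> ('v \<Rightarrow> 'v) \<Rightarrow> real list \<Rightarrow> bool" where
  "eigenvalues_on V T ls \<longleftrightarrow> (\<forall>t. count (mset ls) t = dim {v \<in> V. T v = t *\<^sub>R v})"

section \<open>The quantities built from the almost complex structure\<close>

text \<open>The bivector that the metric identifies with the fundamental two-form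
  \<open>\<omega>(u, v) = g(J u, v)\<close>.\<close>
definition omega :: "(real ^ 4 \<Rightarrow> real ^ 4 ^ 4) \<Rightarrow> (real ^ 4 \<Rightarrow> real ^ 4 ^ 4) \<Rightarrow> real ^ 4 \<Rightarrow> real ^ 4 ^ 4" where
  "omega G J x = raise G x (\<chi> i j. metric G x (J x *v axis i 1) (axis j 1))"

definition star_scalar_curvature :: "(real ^ 4 \<Rightarrow> real ^ 4 ^ 4) \<Rightarrow> (real ^ 4 \<Rightarrow> real ^ 4 ^ 4) \<Rightarrow>
    real ^ 4 \<Rightarrow> real" where
  "star_scalar_curvature G J x = 2 * bivector_form (riem G x) (omega G J x) (omega G J x)"

definition orthonormal :: "(real ^ 4 \<Rightarrow> real ^ 4 ^ 4) \<Rightarrow> real ^ 4 \<Rightarrow> (real ^ 4) list \<Rightarrow> bool" where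
  "orthonormal G x vs \<longleftrightarrow> (\<forall>i<length vs. \<forall>j<length vs.
     metric G x (vs ! i) (vs ! j) = (if i = j then 1 else 0))"

definition H_ohol :: "(real ^ 4 \<Rightarrow> real ^ 4 ^ 4) \<Rightarrow> (real ^ 4 \<Rightarrow> real ^ 4 ^ 4) \<Rightarrow> real ^ 4 \<Rightarrow>
    real ^ 4 \<Rightarrow> real ^ 4 \<Rightarrow> real" where
  "H_ohol G J x X Y = (1/2) *
     (bivector_form (riem G x) (wedge X (J x *v X)) (wedge X (J x *v X)) +
      bivector_form (riem G x) (wedge Y (J x *v Y)) (wedge Y (J x *v Y)))"

definition H_ohol_values :: "(real ^ 4 \<Rightarrow> real ^ 4 ^ 4) \<Rightarrow> (real ^ 4 \<Rightarrow> real ^ 4 ^ 4) \<Rightarrow> real ^ 4 \<Rightarrow>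
    real set" where
  "H_ohol_values G J x =
     {H_ohol G J x X Y | X Y. orthonormal G x [X, J x *v X, Y, J x *v Y]}"

definition is_maximum :: "real set \<Rightarrow> real \<Rightarrow> bool" where
  "is_maximum S m \<longleftrightarrow> m \<in> S \<and> (\<forall>y\<in>S. y \<le> m)"

definition is_minimum :: "real set \<Rightarrow> real \<Rightarrow> bool" where
  "is_minimum S m \<longleftrightarrow> m \<in> S \<and> (\<forall>y\<in>S. m \<le> y)"

end

theory Submission
  imports Defs
begin

text \<open>
  Fix an orthonormal basis \<open>e\<^sub>1, e\<^sub>2 = J e\<^sub>1, e\<^sub>3, e\<^sub>4 = J e\<^sub>3\<close> of the tangent space. For a basis
  \<open>X, JX, Y, JY\<close> of the same kind, \<open>X \<and> JX + Y \<and> JY\<close> is the bivector \<open>\<omega>\<close>, and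
  \<open>\<alpha> = X \<and> JX - Y \<and> JY\<close> is anti-self-dual of norm \<open>\<surd>2\<close>. The parallelogram law turns the orthogonal
  holomorphic sectional curvature into \<open>(R(\<omega>, \<omega>) + R(\<alpha>, \<alpha>)) / 4\<close>, where \<open>R(\<omega>, \<omega>) = s\<^sup>* / 2\<close> and
  \<open>R(\<alpha>, \<alpha>) = W\<^sup>-(\<alpha>, \<alpha>) + s / 6\<close>, because the traceless Ricci tensor does not contribute to the
  anti-self-dual block. The coordinates of \<open>\<alpha>\<close> are the image of \<open>X\<close> under the Hopf map
  \<open>S\<^sup>3 \<rightarrow> S\<^sup>2\<close>, which is onto, so \<open>\<alpha>\<close> runs through the whole sphere and the extrema are those of the
  quadratic form of \<open>W\<^sup>-\<close>. Of the symmetries of the curvature tensor only the skew-symmetry and the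
  pair symmetry are needed; the latter is read off from an expression in Christoffel symbols and
  second derivatives of the metric.
\<close>

section \<open>Symmetry of second derivatives\<close>

text \<open>The mean value theorem is used twice: along \<open>u\<close> for the difference of two
  parallel segments, then along \<open>v\<close> for the derivative \<open>f' y u\<close> so
  obtained. The left side is symmetric in \<open>u\<close> and \<open>v\<close>, which is what the
  next lemma exploits.\<close>

lemma second_difference_mvt:
  fixes f :: "'a::real_normed_vector \<Rightarrow> real"
  assumes f: "\<And>y. y \<in> S \<Longrightarrow> (f has_derivative f' y) (at y)"
    and f': "\<And>y. y \<in> S \<Longrightarrow> ((\<lambda>y. f' y u) has_derivative f'' y) (at y)"
    and S: "\<And>a b. \<lbrakk>0 \<le> a; a \<le> s; 0 \<le> b; b \<le> s\<rbrakk> \<Longrightarrow> x + a *\<^sub>R u + b *\<^sub>R v \<in> S"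
    and s: "0 < s"
  shows "\<exists>a\<in>{0..s}. \<exists>b\<in>{0..s}.
    f (x + s *\<^sub>R u + s *\<^sub>R v) - f (x + s *\<^sub>R u) - f (x + s *\<^sub>R v) + f x =
      s * s * f'' (x + a *\<^sub>R u + b *\<^sub>R v) v"
proof -
  have lin: "linear (f' y)" "linear (f'' y)" if "y \<in> S" for y
    using f[OF that] f'[OF that] by (auto dest: has_derivative_linear)
  \<comment> \<open>The summand with factor 0 is kept so that both terms are instances of fact
    \<open>3\<close>, with \<open>b = s\<close> and \<open>b = 0\<close>.\<close>
  let ?p = "\<lambda>t. f (x + t *\<^sub>R u + s *\<^sub>R v) - f (x + t *\<^sub>R u + 0 *\<^sub>R v)"
  have "\<exists>a\<in>{0<..<s}. ?p s - ?p 0 =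
      (\<lambda>h. f' (x + a *\<^sub>R u + s *\<^sub>R v) (h *\<^sub>R u) - f' (x + a *\<^sub>R u + 0 *\<^sub>R v) (h *\<^sub>R u)) (s - 0)"
  proof (rule mvt_simple[OF s])
    fix t assume t: "0 \<le> t" "t \<le> s"
    have 1: "(f has_derivative f' (x + t *\<^sub>R u + b *\<^sub>R v)) (at (x + t *\<^sub>R u + b *\<^sub>R v))"
      if "0 \<le> b" "b \<le> s" for b using f S t that by blast
    have 2: "((\<lambda>t. x + t *\<^sub>R u + b *\<^sub>R v) has_derivative (\<lambda>h. h *\<^sub>R u)) (at t within {0..s})" for b
      by (auto intro!: derivative_eq_intros)
    have 3: "((\<lambda>t. f (x + t *\<^sub>R u + b *\<^sub>R v)) has_derivative
      (\<lambda>h. f' (x + t *\<^sub>R u + b *\<^sub>R v) (h *\<^sub>R u))) (at t within {0..s})"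
      if "0 \<le> b" "b \<le> s" for b
      using has_derivative_compose[OF 2 1[OF that]] by simp
    show "(?p has_derivative
       (\<lambda>h. f' (x + t *\<^sub>R u + s *\<^sub>R v) (h *\<^sub>R u) - f' (x + t *\<^sub>R u + 0 *\<^sub>R v) (h *\<^sub>R u)))
       (at t within {0..s})"
      by (intro has_derivative_diff 3) (use s in auto)
  qed
  then obtain a where a: "0 < a" "a < s" and pa: "?p s - ?p 0 =
      f' (x + a *\<^sub>R u + s *\<^sub>R v) (s *\<^sub>R u) - f' (x + a *\<^sub>R u + 0 *\<^sub>R v) (s *\<^sub>R u)"
    by auto
  let ?q = "\<lambda>t. f' (x + a *\<^sub>R u + t *\<^sub>R v) u"
  have "\<exists>b\<in>{0<..<s}. ?q s - ?q 0 = (\<lambda>h. f'' (x + a *\<^sub>R u + b *\<^sub>R v) (h *\<^sub>R v)) (s - 0)"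
  proof (rule mvt_simple[OF s])
    fix t assume t: "0 \<le> t" "t \<le> s"
    have 1: "((\<lambda>y. f' y u) has_derivative f'' (x + a *\<^sub>R u + t *\<^sub>R v)) (at (x + a *\<^sub>R u + t *\<^sub>R v))"
      using f' S t a by simp
    have 2: "((\<lambda>t. x + a *\<^sub>R u + t *\<^sub>R v) has_derivative (\<lambda>h. h *\<^sub>R v)) (at t within {0..s})"
      by (auto intro!: derivative_eq_intros)
    show "(?q has_derivative (\<lambda>h. f'' (x + a *\<^sub>R u + t *\<^sub>R v) (h *\<^sub>R v))) (at t within {0..s})"
      using has_derivative_compose[OF 2 1] by simp
  qed
  then obtain b where b: "0 < b" "b < s"
    and qb: "?q s - ?q 0 = f'' (x + a *\<^sub>R u + b *\<^sub>R v) (s *\<^sub>R v)"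
    by auto
  have "?p s - ?p 0 = s * (?q s - ?q 0)"
    using a s S[of a 0] S[of a s]
    by (simp add: pa lin linear_cmul[OF lin(1)] right_diff_distrib del: scaleR_zero_left add_0_right)
  also have "\<dots> = s * s * f'' (x + a *\<^sub>R u + b *\<^sub>R v) v"
    using a b S[of a b] unfolding qb by (simp add: linear_cmul[OF lin(2)])
  finally show ?thesis
    using a b by (intro bexI[of _ a] bexI[of _ b]) auto
qed

text \<open>Here \<open>f'' w y w'\<close> differentiates first along \<open>w\<close>, then along
  \<open>w'\<close>. On a small parallelogram the second difference is \<open>s * s\<close> times a
  value of either mixed derivative, and by continuity both values are close to those at
  \<open>x\<close>.\<close>

lemma symmetric_second_derivative:
  fixes f :: "'a::real_normed_vector \<Rightarrow> real"
  assumes "open S" and x: "x \<in> S"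
    and f: "\<And>y. y \<in> S \<Longrightarrow> (f has_derivative f' y) (at y)"
    and f': "\<And>y w. y \<in> S \<Longrightarrow> ((\<lambda>y. f' y w) has_derivative f'' w y) (at y)"
    and cont: "\<And>w w'. continuous_on S (\<lambda>y. f'' w y w')"
  shows "f'' u x v = f'' v x u"
proof (rule ccontr)
  assume neq: "f'' u x v \<noteq> f'' v x u"
  \<comment> \<open>Half the gap: no number lies within \<open>e\<close> of both mixed derivatives
    at \<open>x\<close>.\<close>
  define e where "e = \<bar>f'' u x v - f'' v x u\<bar> / 2"
  have e: "e > 0" using neq by (simp add: e_def)
  have "isCont (\<lambda>y. f'' w y w') x" for w w'
    using cont \<open>open S\<close> x continuous_on_eq_continuous_at by blast
  then have "\<forall>\<^sub>F y in at x. dist (f'' w y w') (f'' w x w') < e" for w w'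
    using e by (simp add: isCont_def tendsto_iff)
  then have "\<forall>\<^sub>F y in nhds x. dist (f'' w y w') (f'' w x w') < e" for w w'
    using e by (simp add: eventually_at_filter eventually_mono) (smt (verit, best) dist_self eventually_mono)
  moreover have "\<forall>\<^sub>F y in nhds x. y \<in> S"
    using \<open>open S\<close> x by (simp add: eventually_nhds_in_open)
  ultimately have "\<forall>\<^sub>F y in nhds x. y \<in> S \<and> dist (f'' u y v) (f'' u x v) < e \<and>
      dist (f'' v y u) (f'' v x u) < e"
    by (intro eventually_conj)
  then obtain d where d: "d > 0"
    and dS: "\<And>y. dist y x < d \<Longrightarrow> y \<in> S \<and> dist (f'' u y v) (f'' u x v) < e \<and>
      dist (f'' v y u) (f'' v x u) < e"
    by (auto simp: eventually_nhds_metric)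
  \<comment> \<open>The summand 1 keeps \<open>N\<close> positive even for \<open>u = v = 0\<close>;
    side length \<open>d / (2 * N)\<close> keeps the parallelogram within \<open>d / 2\<close> of
    \<open>x\<close>.\<close>
  define N where "N = 1 + norm u + norm v"
  have pos: "N > 0" unfolding N_def by (smt (verit) norm_ge_zero)
  define s where "s = d / (2 * N)"
  have s: "s > 0" using d pos by (simp add: s_def)
  have near: "dist (x + a *\<^sub>R u + b *\<^sub>R v) x < d"
    if "0 \<le> a" "a \<le> s" "0 \<le> b" "b \<le> s" for a b
  proof -
    have "dist (x + a *\<^sub>R u + b *\<^sub>R v) x \<le> a * norm u + b * norm v"
      using that norm_triangle_ineq[of "a *\<^sub>R u" "b *\<^sub>R v"] by (simp add: dist_norm add.assoc)
    also have "\<dots> \<le> s * norm u + s * norm v"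
      using that by (intro add_mono mult_right_mono) auto
    also have "\<dots> \<le> s * N" using s by (simp add: N_def algebra_simps)
    also have "\<dots> = d / 2" using pos by (simp add: s_def)
    also have "\<dots> < d" using d by simp
    finally show ?thesis .
  qed
  obtain a b where ab: "a \<in> {0..s}" "b \<in> {0..s}"
    "f (x + s *\<^sub>R u + s *\<^sub>R v) - f (x + s *\<^sub>R u) - f (x + s *\<^sub>R v) + f x =
      s * s * f'' u (x + a *\<^sub>R u + b *\<^sub>R v) v"
    using second_difference_mvt[of S f f' u "f'' u" s x v, OF f f' _ s] near dS by blast
  obtain a' b' where ab': "a' \<in> {0..s}" "b' \<in> {0..s}"
    "f (x + s *\<^sub>R v + s *\<^sub>R u) - f (x + s *\<^sub>R v) - f (x + s *\<^sub>R u) + f x =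
      s * s * f'' v (x + a' *\<^sub>R v + b' *\<^sub>R u) u"
  proof -
    have "x + a *\<^sub>R v + b *\<^sub>R u \<in> S" if "0 \<le> a" "a \<le> s" "0 \<le> b" "b \<le> s" for a b
      using dS near[OF that(3,4,1,2)] by (simp add: add.assoc add.commute[of "a *\<^sub>R v"])
    then show thesis
      using second_difference_mvt[of S f f' v "f'' v" s x u, OF f f' _ s] that by blast
  qed
  have comm: "x + c *\<^sub>R v + d *\<^sub>R u = x + d *\<^sub>R u + c *\<^sub>R v" for c d
    by simp
  have "s * s * f'' u (x + a *\<^sub>R u + b *\<^sub>R v) v = s * s * f'' v (x + b' *\<^sub>R u + a' *\<^sub>R v) u"
    using ab(3) ab'(3) unfolding comm by linarith
  then have "f'' u (x + a *\<^sub>R u + b *\<^sub>R v) v = f'' v (x + b' *\<^sub>R u + a' *\<^sub>R v) u"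
    using s by simp
  moreover have "dist (f'' u (x + a *\<^sub>R u + b *\<^sub>R v) v) (f'' u x v) < e"
    using dS[OF near[of a b]] ab by simp
  moreover have "dist (f'' v (x + b' *\<^sub>R u + a' *\<^sub>R v) u) (f'' v x u) < e"
    using dS[OF near[of b' a']] ab' by simp
  ultimately show False unfolding e_def dist_real_def by argo
qed

section \<open>Pair symmetry of the curvature tensor\<close>

lemma has_derivative_matrix_vector_mult [derivative_intros]:
  fixes A :: "'a::real_normed_vector \<Rightarrow> real ^ 'n ^ 'm"
  assumes "(A has_derivative A') (at x within S)" "(b has_derivative b') (at x within S)"
  shows "((\<lambda>x. A x *v b x) has_derivative (\<lambda>h. A x *v b' h + A' h *v b x)) (at x within S)"
proof -
  have "bilinear ((*v) :: real ^ 'n ^ 'm \<Rightarrow> real ^ 'n \<Rightarrow> real ^ 'm)"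
    by (auto simp: bilinear_def linear_iff algebra_simps scaleR_matrix_vector_assoc)
  then have "bounded_bilinear ((*v) :: real ^ 'n ^ 'm \<Rightarrow> real ^ 'n \<Rightarrow> real ^ 'm)"
    by (simp add: bilinear_conv_bounded_bilinear)
  from bounded_bilinear.FDERIV[OF this assms] show ?thesis .
qed

section \<open>Differentiability of determinants and inverse matrices\<close>

lemma differentiable_prod:
  fixes f :: "'i \<Rightarrow> 'a::real_normed_vector \<Rightarrow> real"
  assumes "\<And>i. i \<in> I \<Longrightarrow> f i differentiable (at x within S)"
  shows "(\<lambda>x. \<Prod>i\<in>I. f i x) differentiable (at x within S)"
proof -
  obtain f' where "(f i has_derivative f' i) (at x within S)" if "i \<in> I" for i
    using assms unfolding differentiable_def by metis
  from has_derivative_prod[of I f f', OF this] show ?thesis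
    by (auto simp: differentiable_def)
qed

lemma differentiable_det:
  fixes A :: "'a::real_normed_vector \<Rightarrow> real ^ 'n ^ 'n"
  assumes "\<And>i j. (\<lambda>x. A x $ i $ j) differentiable (at x within S)"
  shows "(\<lambda>x. det (A x)) differentiable (at x within S)"
  unfolding det_def
  by (intro differentiable_sum ballI differentiable_mult differentiable_const differentiable_prod assms)
    (simp add: finite_permutations)

lemma differentiable_vec_nth:
  fixes f :: "'a::real_normed_vector \<Rightarrow> ('b::real_normed_vector) ^ 'n"
  assumes "f differentiable (at x within S)"
  shows "(\<lambda>x. f x $ i) differentiable (at x within S)"
  using assms bounded_linear.has_derivative[OF bounded_linear_vec_nth]
  unfolding differentiable_def by blast

lemma differentiable_vecI:
  fixes f :: "'a::real_normed_vector \<Rightarrow> ('b::euclidean_space) ^ 'n"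
  assumes "\<And>i. (\<lambda>x. f x $ i) differentiable (at x within S)"
  shows "f differentiable (at x within S)"
proof -
  obtain f' where f': "((\<lambda>x. f x $ i) has_derivative f' i) (at x within S)" for i
    using assms unfolding differentiable_def by metis
  have "((\<lambda>x. f x \<bullet> axis i b) has_derivative (\<lambda>h. (\<chi> i. f' i h) \<bullet> axis i b)) (at x within S)"
    for i b
    using has_derivative_inner_left[OF f'[of i]] by (simp add: inner_axis)
  then have "(f has_derivative (\<lambda>h. \<chi> i. f' i h)) (at x within S)"
    unfolding has_derivative_componentwise_within[of f] Basis_vec_def by auto
  then show ?thesis by (auto simp: differentiable_def)
qed

lemma matrix_inv_mult:
  fixes A :: "real ^ 'n ^ 'n"
  assumes "invertible A"
  shows "A ** matrix_inv A = mat 1" "matrix_inv A ** A = mat 1"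
  using someI_ex[OF assms[unfolded invertible_def]] by (auto simp: matrix_inv_def)

text \<open>Cramer's rule for the column \<open>matrix_inv A *v axis l 1\<close>. It exhibits each
  entry of the inverse as a quotient of determinants, hence as a differentiable function of the
  entries of \<open>A\<close>.\<close>

lemma matrix_inv_component:
  fixes A :: "real ^ 'n ^ 'n"
  assumes "invertible A"
  shows "matrix_inv A $ k $ l = det (\<chi> i j. if j = k then axis l 1 $ i else A $ i $ j) / det A"
proof -
  have "A *v (matrix_inv A *v axis l 1) = axis l 1"
    by (simp add: matrix_vector_mul_assoc matrix_inv_mult[OF assms])
  then have "matrix_inv A *v axis l 1 =
      (\<chi> k. det (\<chi> i j. if j = k then axis l 1 $ i else A $ i $ j) / det A)"
    using assms by (subst (asm) cramer) (auto simp: invertible_det_nz)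
  then show ?thesis
    by (simp add: matrix_vector_mult_basis vec_eq_iff column_def)
qed

lemma differentiable_matrix_inv:
  fixes A :: "'a::real_normed_vector \<Rightarrow> real ^ 'n ^ 'n"
  assumes "A differentiable (at x)" "open S" "x \<in> S" "\<And>y. y \<in> S \<Longrightarrow> invertible (A y)"
  shows "(\<lambda>x. matrix_inv (A x)) differentiable (at x)"
proof (intro differentiable_vecI)
  fix k l
  have A: "(\<lambda>x. A x $ i $ j) differentiable at x" for i j
    using assms(1) by (intro differentiable_vec_nth)
  have "(\<lambda>x. det (\<chi> i j. if j = k then axis l 1 $ i else A x $ i $ j) / det (A x))
      differentiable at x"
  proof (intro differentiable_divide differentiable_det)
    fix i j
    show "(\<lambda>x. (\<chi> i j. if j = k then axis l 1 $ i else A x $ i $ j) $ i $ j) differentiable at x"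
      using A by (cases "j = k") auto
  qed (use assms A in \<open>auto simp: invertible_det_nz intro: differentiable_det\<close>)
  then obtain D where "((\<lambda>x. det (\<chi> i j. if j = k then axis l 1 $ i else A x $ i $ j) / det (A x))
      has_derivative D) (at x)"
    by (auto simp: differentiable_def)
  \<comment> \<open>The Cramer quotient agrees with the inverse wherever \<open>A\<close> is
    invertible, so on the whole neighbourhood \<open>S\<close>, and the derivative carries
    over.\<close>
  then have "((\<lambda>x. matrix_inv (A x) $ k $ l) has_derivative D) (at x)"
    by (rule has_derivative_transform_within_open[OF _ assms(2,3)])
      (simp add: matrix_inv_component assms(4))
  then show "(\<lambda>x. matrix_inv (A x) $ k $ l) differentiable at x"
    by (auto simp: differentiable_def)
qed

lemma differentiable_matrix_vector_mult:
  fixes A :: "'a::real_normed_vector \<Rightarrow> real ^ 'n ^ 'm"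
  assumes "A differentiable (at x within S)" "b differentiable (at x within S)"
  shows "(\<lambda>x. A x *v b x) differentiable (at x within S)"
  using assms has_derivative_matrix_vector_mult unfolding differentiable_def by blast

lemma linear_axis_expansion:
  fixes f :: "real ^ 'n \<Rightarrow> 'b::real_vector"
  assumes "linear f"
  shows "f v = (\<Sum>i\<in>UNIV. v $ i *\<^sub>R f (axis i 1))"
proof -
  have "f v = f (\<Sum>i\<in>UNIV. v $ i *s axis i 1)"
    by (simp add: basis_expansion)
  then show ?thesis
    by (simp add: linear_sum[OF assms] linear_cmul[OF assms] scalar_mult_eq_scaleR)
qed

lemma inner_symmetric_matrix:
  fixes A :: "real ^ 'n ^ 'n"
  assumes "\<And>i j. A $ i $ j = A $ j $ i"
  shows "a \<bullet> (A *v b) = b \<bullet> (A *v a)"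
proof -
  have "transpose A = A" using assms by (simp add: vec_eq_iff transpose_def)
  then show ?thesis
    by (metis dot_lmul_matrix inner_commute transpose_matrix_vector)
qed

section \<open>The metric in one chart, its derivatives and the Christoffel symbols\<close>

locale c2_metric =
  fixes G :: "real ^ 4 \<Rightarrow> real ^ 4 ^ 4" and S :: "(real ^ 4) set"
  assumes open_S: "open S"
    and C2: "Ck_on 2 G S"
    and metric_sym: "y \<in> S \<Longrightarrow> metric G y u v = metric G y v u"
    and metric_pos: "y \<in> S \<Longrightarrow> v \<noteq> 0 \<Longrightarrow> metric G y v v > 0"
begin

abbreviation "D y v \<equiv> frechet_derivative G (at y) v"
abbreviation "H y v w \<equiv> frechet_derivative (\<lambda>y. D y v) (at y) w"

lemma G_diff: "y \<in> S \<Longrightarrow> (G has_derivative D y) (at y)"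
  using C2 open_S by (simp add: numeral_2_eq_2 differentiable_on_eq_differentiable_at frechet_derivative_works)

lemma D_diff: "y \<in> S \<Longrightarrow> ((\<lambda>y. D y v) has_derivative H y v) (at y)"
  using C2 open_S by (simp add: numeral_2_eq_2 differentiable_on_eq_differentiable_at frechet_derivative_works)

lemma H_cont: "continuous_on S (\<lambda>y. H y v w)"
  using C2 by (simp add: numeral_2_eq_2)

lemma D_linear: "y \<in> S \<Longrightarrow> linear (D y)"
  using G_diff has_derivative_linear by blast

lemma D_component: "y \<in> S \<Longrightarrow> frechet_derivative (\<lambda>y. G y $ i $ j) (at y) v = D y v $ i $ j"
proof -
  assume "y \<in> S"
  then have "((\<lambda>y. G y $ i $ j) has_derivative (\<lambda>v. D y v $ i $ j)) (at y)"
    by (intro bounded_linear.has_derivative[OF bounded_linear_vec_nth] G_diff)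
  from frechet_derivative_at[OF this] show ?thesis by (metis (no_types, lifting))
qed

lemma H_sym: assumes "y \<in> S" shows "H y v w = H y w v"
proof -
  \<comment> \<open>Entry by entry, because the symmetry of second derivatives was shown for
    real-valued functions.\<close>
  have "H y v w $ i $ j = H y w v $ i $ j" for i j
    by (rule symmetric_second_derivative[OF open_S assms, where f = "\<lambda>y. G y $ i $ j"
        and f' = "\<lambda>y v. D y v $ i $ j" and f'' = "\<lambda>v y w. H y v w $ i $ j"])
      (auto intro!: bounded_linear.has_derivative[OF bounded_linear_vec_nth] G_diff D_diff
        continuous_on_component H_cont)
  then show ?thesis by (simp add: vec_eq_iff)
qed

lemma G_transpose: assumes "y \<in> S" shows "transpose (G y) = G y"
proof -
  have "axis i 1 \<bullet> (G y *v axis j 1) = axis j 1 \<bullet> (G y *v axis i 1)" for i j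
    using metric_sym[OF assms] by (simp add: metric_def)
  then show ?thesis
    by (simp add: vec_eq_iff matrix_vector_mult_basis inner_axis' column_def transpose_def)
qed

lemma G_sym: "y \<in> S \<Longrightarrow> G y $ i $ j = G y $ j $ i"
  using G_transpose[of y] by (simp add: vec_eq_iff transpose_def)

lemma D_sym: assumes "y \<in> S" shows "D y v $ i $ j = D y v $ j $ i"
proof -
  have "((\<lambda>y. G y $ j $ i) has_derivative (\<lambda>v. D y v $ i $ j)) (at y)"
    by (rule has_derivative_transform_within_open[where f = "\<lambda>y. G y $ i $ j"])
      (use assms in \<open>auto intro!: bounded_linear.has_derivative[OF bounded_linear_vec_nth]
        G_diff simp: open_S G_sym\<close>)
  from frechet_derivative_at[OF this] show ?thesis
    using D_component[OF assms] by metis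
qed

lemma H_sym_entries: assumes "y \<in> S" shows "H y v w $ i $ j = H y v w $ j $ i"
proof -
  have *: "((\<lambda>y. D y v $ i $ j) has_derivative (\<lambda>w. H y v w $ i $ j)) (at y)" for i j
    using assms by (auto intro!: bounded_linear.has_derivative[OF bounded_linear_vec_nth] D_diff)
  have "((\<lambda>y. D y v $ j $ i) has_derivative (\<lambda>w. H y v w $ i $ j)) (at y)"
    by (rule has_derivative_transform_within_open[OF * open_S assms]) (simp add: D_sym)
  from has_derivative_unique[OF this *] show ?thesis by metis
qed

lemma G_invertible: assumes "y \<in> S" shows "invertible (G y)"
proof -
  have "v = 0" if "G y *v v = 0" for v
    using metric_pos[OF assms, of v] that by (force simp: metric_def)
  then show ?thesis
    by (simp add: invertible_left_inverse matrix_left_invertible_ker)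
qed

text \<open>Christoffel symbols of the first kind.\<close>
definition Gamma1 :: "real ^ 4 \<Rightarrow> real ^ 4 \<Rightarrow> real ^ 4 \<Rightarrow> real ^ 4" where
  "Gamma1 y v w = (1/2) *\<^sub>R (D y v *v w + D y w *v v - (\<chi> l. v \<bullet> (D y (axis l 1) *v w)))"

text \<open>Kept in the index form of \<open>christoffel\<close>, so that \<open>nabla_const\<close>
  follows by unfolding; \<open>Gamma_eq\<close> supplies the matrix form used in
  calculations.\<close>

definition Gamma :: "real ^ 4 \<Rightarrow> real ^ 4 \<Rightarrow> real ^ 4 \<Rightarrow> real ^ 4" where
  "Gamma y v w = (\<chi> k. \<Sum>i\<in>UNIV. \<Sum>j\<in>UNIV. christoffel G y k i j * v $ i * w $ j)"


text \<open>The Koszul formula for fields with constant components. Linearity of \<open>D y\<close>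
  resums the last summand of \<open>Gamma1\<close> over the components of \<open>z\<close>.\<close>

lemma Gamma1_inner:
  assumes "y \<in> S"
  shows "z \<bullet> Gamma1 y v w =
    (z \<bullet> (D y v *v w) + z \<bullet> (D y w *v v) - v \<bullet> (D y z *v w)) / 2"
proof -
  have lin: "linear (\<lambda>z. v \<bullet> (D y z *v w))"
    using D_linear[OF assms]
    by (auto simp: linear_iff matrix_vector_mult_add_rdistrib inner_add_right
        simp flip: scaleR_matrix_vector_assoc)
  have "z \<bullet> (\<chi> l. v \<bullet> (D y (axis l 1) *v w)) = v \<bullet> (D y z *v w)"
    by (subst linear_axis_expansion[OF lin, of z]) (simp add: inner_vec_def)
  then show ?thesis
    by (simp add: Gamma1_def inner_diff_right inner_add_right)
qed

lemma D_inner_sym: "y \<in> S \<Longrightarrow> a \<bullet> (D y v *v b) = b \<bullet> (D y v *v a)"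
  by (intro inner_symmetric_matrix D_sym)

lemma H_inner_sym: "y \<in> S \<Longrightarrow> a \<bullet> (H y v w *v b) = b \<bullet> (H y v w *v a)"
  by (intro inner_symmetric_matrix H_sym_entries)

text \<open>Both sides are expanded in the array \<open>P\<close> of first partial derivatives of
  the metric; its symmetry in the last two indices and an exchange of sums make them agree.\<close>

lemma Gamma_eq: assumes "y \<in> S" shows "Gamma y v w = matrix_inv (G y) *v Gamma1 y v w"
proof -
  define P where "P = (\<lambda>i j k. D y (axis i 1) $ j $ k)"
  have P: "P i j k = P i k j" for i j k
    using D_sym[OF assms] by (simp add: P_def)
  have lin: "linear (\<lambda>v. D y v $ i $ j)" for i j
    using D_linear[OF assms] by (auto simp: linear_iff)
  have D: "D y v $ i $ j = (\<Sum>k\<in>UNIV. v $ k * P k i j)" for v i j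
    using linear_axis_expansion[OF lin, of v i j] by (simp add: P_def)
  have 1: "Gamma1 y v w $ l = (\<Sum>i\<in>UNIV. \<Sum>j\<in>UNIV.
      (P i j l + P j i l - P l i j) * v $ i * w $ j) / 2" for l
  proof -
    have "(D y v *v w) $ l = (\<Sum>i\<in>UNIV. \<Sum>j\<in>UNIV. P i j l * v $ i * w $ j)"
      unfolding matrix_vector_mult_def D
      by (simp add: sum_distrib_left sum_distrib_right, subst sum.swap)
        (simp add: P[of _ l] mult_ac)
    moreover have "(D y w *v v) $ l = (\<Sum>i\<in>UNIV. \<Sum>j\<in>UNIV. P j i l * v $ i * w $ j)"
      unfolding matrix_vector_mult_def D
      by (simp add: sum_distrib_left sum_distrib_right P[of _ l] mult_ac)
    moreover have "v \<bullet> (D y (axis l 1) *v w) = (\<Sum>i\<in>UNIV. \<Sum>j\<in>UNIV. P l i j * v $ i * w $ j)"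
      by (simp add: matrix_vector_mult_def inner_vec_def sum_distrib_left P_def mult_ac)
    ultimately show ?thesis
      by (simp add: Gamma1_def sum.distrib sum_subtractf algebra_simps)
  qed
  have "Gamma y v w $ k = (matrix_inv (G y) *v Gamma1 y v w) $ k" for k
  proof -
    have "Gamma y v w $ k = (\<Sum>i\<in>UNIV. \<Sum>j\<in>UNIV. \<Sum>l\<in>UNIV.
        matrix_inv (G y) $ k $ l * ((P i j l + P j i l - P l i j) * v $ i * w $ j / 2))"
      by (simp add: Gamma_def christoffel_def D_component[OF assms] sum_distrib_left
          sum_distrib_right mult_ac P_def)
    also have "\<dots> = (\<Sum>i\<in>UNIV. \<Sum>l\<in>UNIV. \<Sum>j\<in>UNIV.
        matrix_inv (G y) $ k $ l * ((P i j l + P j i l - P l i j) * v $ i * w $ j / 2))"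
      by (subst sum.swap) (rule refl)
    also have "\<dots> = (\<Sum>l\<in>UNIV. \<Sum>i\<in>UNIV. \<Sum>j\<in>UNIV.
        matrix_inv (G y) $ k $ l * ((P i j l + P j i l - P l i j) * v $ i * w $ j / 2))"
      by (rule sum.swap)
    also have "\<dots> = (matrix_inv (G y) *v Gamma1 y v w) $ k"
      by (simp add: matrix_vector_mult_def 1 sum_distrib_left sum_divide_distrib)
    finally show ?thesis .
  qed
  then show ?thesis by (simp add: vec_eq_iff)
qed

lemma G_Gamma: "y \<in> S \<Longrightarrow> G y *v Gamma y v w = Gamma1 y v w"
  by (simp add: Gamma_eq matrix_vector_mul_assoc matrix_inv_mult(1) G_invertible)

text \<open>Vanishing torsion. The first two summands of \<open>Gamma1\<close> swap, and the third
  is symmetric because every derivative of \<open>G\<close> is a symmetric matrix.\<close>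

lemma Gamma_commute:
  assumes "y \<in> S" shows "Gamma y v w = Gamma y w v"
proof -
  have "Gamma1 y v w = Gamma1 y w v"
    unfolding Gamma1_def using D_inner_sym[OF assms, of v _ w] by (simp add: add.commute)
  then show ?thesis by (simp add: Gamma_eq[OF assms])
qed

lemma Gamma1_differentiable:
  assumes "x \<in> S" shows "(\<lambda>y. Gamma1 y v w) differentiable at x"
proof (rule differentiable_vecI)
  fix l
  have D: "(\<lambda>y. D y v) differentiable at x" for v
    using D_diff[OF assms] by (auto simp: differentiable_def)
  have "(\<lambda>y. (1/2) * ((D y v *v w) $ l + (D y w *v v) $ l - v \<bullet> (D y (axis l 1) *v w)))
      differentiable at x"
    by (intro differentiable_mult differentiable_const differentiable_add differentiable_diff
        differentiable_vec_nth differentiable_matrix_vector_mult D differentiable_inner)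
  then show "(\<lambda>y. Gamma1 y v w $ l) differentiable at x"
    by (simp add: Gamma1_def)
qed

lemma Gamma_differentiable:
  assumes "x \<in> S" shows "(\<lambda>y. Gamma y v w) differentiable at x"
proof -
  have "(\<lambda>y. matrix_inv (G y) *v Gamma1 y v w) differentiable at x"
    using G_diff[OF assms] assms open_S
    by (intro differentiable_matrix_vector_mult differentiable_matrix_inv Gamma1_differentiable)
      (auto simp: differentiable_def G_invertible)
  then obtain D' where "((\<lambda>y. matrix_inv (G y) *v Gamma1 y v w) has_derivative D') (at x)"
    by (auto simp: differentiable_def)
  then have "((\<lambda>y. Gamma y v w) has_derivative D') (at x)"
    by (rule has_derivative_transform_within_open[OF _ open_S assms]) (simp add: Gamma_eq)
  then show ?thesis by (auto simp: differentiable_def)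
qed

section \<open>Curvature in terms of Christoffel symbols and second derivatives of the
  metric\<close>

abbreviation "dGamma x v w u \<equiv> frechet_derivative (\<lambda>y. Gamma y v w) (at x) u"

lemma nabla_const: "nabla G (\<lambda>_. v) Y = (\<lambda>y. frechet_derivative Y (at y) v + Gamma y v (Y y))"
  by (simp add: nabla_def Gamma_def)

text \<open>Constant fields commute, so the bracket term drops out, and the covariant derivative of
  a constant field is just \<open>Gamma\<close>.\<close>

lemma curvature_eq:
  "curvature G x u v w = dGamma x v w u - dGamma x u w v
    + Gamma x u (Gamma x v w) - Gamma x v (Gamma x u w)"
proof -
  have "lie_bracket (\<lambda>_. u) (\<lambda>_. v) = (\<lambda>_. 0)"
    by (simp add: lie_bracket_def)
  moreover have "nabla G (\<lambda>_. 0) (\<lambda>_. w) x = 0"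
    by (simp add: nabla_def vec_eq_iff)
  ultimately show ?thesis
    by (simp add: curvature_def curvature_field_def nabla_const)
qed

text \<open>Differentiating the Koszul formula for \<open>z \<bullet> (G y *v Gamma y v w)\<close>
  avoids any derivative of the inverse matrix; the product rule leaves the correction with
  \<open>D x u\<close>.\<close>

lemma dGamma_inner:
  assumes "x \<in> S"
  shows "z \<bullet> (G x *v dGamma x v w u) =
    (z \<bullet> (H x v u *v w) + z \<bullet> (H x w u *v v) - v \<bullet> (H x z u *v w)) / 2
    - z \<bullet> (D x u *v Gamma x v w)"
proof -
  have Gamma: "((\<lambda>y. Gamma y v w) has_derivative (\<lambda>u. dGamma x v w u)) (at x)"
    using Gamma_differentiable[OF assms] by (simp add: frechet_derivative_works)
  have "((\<lambda>y. z \<bullet> (G y *v Gamma y v w)) has_derivative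
      (\<lambda>u. z \<bullet> (G x *v dGamma x v w u + D x u *v Gamma x v w))) (at x)"
    by (intro has_derivative_inner_right has_derivative_matrix_vector_mult G_diff Gamma assms)
  moreover have "((\<lambda>y. z \<bullet> (G y *v Gamma y v w)) has_derivative (\<lambda>u.
      (z \<bullet> (H x v u *v w) + z \<bullet> (H x w u *v v) - v \<bullet> (H x z u *v w)) / 2)) (at x)"
    by (rule has_derivative_transform_within_open[OF _ open_S assms, where f = "\<lambda>y.
        (z \<bullet> (D y v *v w) + z \<bullet> (D y w *v v) - v \<bullet> (D y z *v w)) / 2"])
      (auto intro!: derivative_eq_intros D_diff assms simp: G_Gamma Gamma1_inner)
  ultimately have "z \<bullet> (G x *v dGamma x v w u + D x u *v Gamma x v w) =
      (z \<bullet> (H x v u *v w) + z \<bullet> (H x w u *v v) - v \<bullet> (H x z u *v w)) / 2"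
    by (rule fun_cong[OF has_derivative_unique])
  then show ?thesis unfolding matrix_vector_right_distrib inner_add_right by argo
qed

text \<open>Formula \<open>*\<close> below writes the curvature through second derivatives of
  \<open>G\<close> and products of Christoffel terms. Exchanging the pairs permutes these terms, by
  symmetry of \<open>H\<close> in its directions and its entries and by
  \<open>Gamma_commute\<close>.\<close>

lemma riem_pair_sym:
  assumes x: "x \<in> S"
  shows "riem G x u v a b = riem G x a b u v"
proof -
  \<comment> \<open>Metric compatibility for the constant vector \<open>a\<close> and the vector
    \<open>Gamma x v b\<close>: it merges the quadratic term with the correction from
    \<open>dGamma_inner\<close>.\<close>
  have quad: "a \<bullet> (G x *v Gamma x u (Gamma x v b)) - a \<bullet> (D x u *v Gamma x v b)
      = - metric G x (Gamma x v b) (Gamma x u a)" for u v a b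
  proof -
    show ?thesis
      using D_inner_sym[OF x, of "Gamma x v b" u a] D_inner_sym[OF x, of "Gamma x v b" a u]
        D_inner_sym[OF x, of u "Gamma x v b" a]
      unfolding metric_def G_Gamma[OF x] Gamma1_inner[OF x] by argo
  qed
  \<comment> \<open>The two terms with second derivatives along both \<open>u\<close> and
    \<open>v\<close> cancel by \<open>H_sym\<close>, leaving four.\<close>
  have *: "riem G x u v a b = (a \<bullet> (H x b u *v v) - b \<bullet> (H x a u *v v)
      - a \<bullet> (H x b v *v u) + b \<bullet> (H x a v *v u)) / 2
      - metric G x (Gamma x v b) (Gamma x u a) + metric G x (Gamma x u b) (Gamma x v a)"
    for u v a b
  proof -
    have "riem G x u v a b = a \<bullet> (G x *v curvature G x u v b)"
      using metric_sym[OF x, of _ a] by (simp add: riem_def) (simp add: metric_def)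
    also have "\<dots> = a \<bullet> (G x *v dGamma x v b u) - a \<bullet> (G x *v dGamma x u b v)
        + a \<bullet> (G x *v Gamma x u (Gamma x v b)) - a \<bullet> (G x *v Gamma x v (Gamma x u b))"
      by (simp add: curvature_eq matrix_vector_mult_diff_distrib matrix_vector_right_distrib
          inner_diff_right inner_add_right)
    also have "\<dots> = (a \<bullet> (H x b u *v v) - b \<bullet> (H x a u *v v)
      - a \<bullet> (H x b v *v u) + b \<bullet> (H x a v *v u)) / 2
      - metric G x (Gamma x v b) (Gamma x u a) + metric G x (Gamma x u b) (Gamma x v a)"
      using quad[of a u v b] quad[of a v u b] H_inner_sym[OF x, of u a v b]
        H_inner_sym[OF x, of v a u b]
      unfolding dGamma_inner[OF x] H_sym[OF x, of u v] by argo
    finally show ?thesis .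
  qed
  show ?thesis
    using metric_sym[OF x, of "Gamma x u b" "Gamma x v a"]
      H_inner_sym[OF x, of a b u v] H_inner_sym[OF x, of b a u v]
      H_inner_sym[OF x, of a b v u] H_inner_sym[OF x, of b a v u]
    unfolding *[of u v a b] *[of a b u v] H_sym[OF x, of v a] H_sym[OF x, of v b]
      H_sym[OF x, of u a] H_sym[OF x, of u b] Gamma_commute[OF x, of a]
      Gamma_commute[OF x, of b]
    by argo
qed

lemma riem_skew: "riem G x u v a b = - riem G x v u a b"
  by (simp add: riem_def curvature_eq metric_def inner_diff_left inner_add_left)

lemma riem_linear3: "linear (\<lambda>a. riem G x u v a b)"
  by (auto simp: linear_iff riem_def metric_def algebra_simps)

end

section \<open>Bivectors in \<open>\<real>\<^sup>4\<close>\<close>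

lemma det_4:
  fixes A :: "'a::comm_ring_1 ^ 4 ^ 4"
  shows "det A =
    A$1$1 * (A$2$2 * (A$3$3 * A$4$4 - A$3$4 * A$4$3) - A$2$3 * (A$3$2 * A$4$4 - A$3$4 * A$4$2)
      + A$2$4 * (A$3$2 * A$4$3 - A$3$3 * A$4$2)) -
    A$1$2 * (A$2$1 * (A$3$3 * A$4$4 - A$3$4 * A$4$3) - A$2$3 * (A$3$1 * A$4$4 - A$3$4 * A$4$1)
      + A$2$4 * (A$3$1 * A$4$3 - A$3$3 * A$4$1)) +
    A$1$3 * (A$2$1 * (A$3$2 * A$4$4 - A$3$4 * A$4$2) - A$2$2 * (A$3$1 * A$4$4 - A$3$4 * A$4$1)
      + A$2$4 * (A$3$1 * A$4$2 - A$3$2 * A$4$1)) -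
    A$1$4 * (A$2$1 * (A$3$2 * A$4$3 - A$3$3 * A$4$2) - A$2$2 * (A$3$1 * A$4$3 - A$3$3 * A$4$1)
      + A$2$3 * (A$3$1 * A$4$2 - A$3$2 * A$4$1))"
proof -
  have f1234: "finite {2::4, 3, 4}" "1 \<notin> {2::4, 3, 4}" by auto
  have f234: "finite {3::4, 4}" "2 \<notin> {3::4, 4}" by auto
  have f34: "finite {4::4}" "3 \<notin> {4::4}" by auto
  show ?thesis
    unfolding det_def UNIV_4
    unfolding sum_over_permutations_insert[OF f1234]
    unfolding sum_over_permutations_insert[OF f234]
    unfolding sum_over_permutations_insert[OF f34]
    unfolding permutes_sing
    by (simp add: sign_swap_id permutation_swap_id permutation_compose sign_compose sign_id
        swap_id_eq algebra_simps)
qed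

lemma vector_4 [simp]:
  "(vector [w, x, y, z] :: 'a::zero ^ 4) $ 1 = w"
  "(vector [w, x, y, z] :: 'a ^ 4) $ 2 = x"
  "(vector [w, x, y, z] :: 'a ^ 4) $ 3 = y"
  "(vector [w, x, y, z] :: 'a ^ 4) $ 4 = z"
  unfolding vector_def by simp_all

text \<open>\<open>frame\<close> stores its vectors as rows, so a map applied to each of them
  becomes right multiplication by the transpose.\<close>

lemma frame_mult_transpose:
  "frame (A *v a) (A *v b) (A *v c) (A *v d) = frame a b c d ** transpose A"
  by (simp add: vec_eq_iff forall_4 frame_def matrix_matrix_mult_def matrix_vector_mult_def
      transpose_def mult.commute)

lemma det_frame_mult:
  "det (frame (A *v a) (A *v b) (A *v c) (A *v d)) = det A * det (frame a b c d)"
  by (simp add: frame_mult_transpose det_mul mult.commute)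

lemma bilinear_det_frame_34: "bilinear (\<lambda>u v. det (frame a b u v))"
  by (simp add: bilinear_def linear_iff det_4 frame_def algebra_simps)

lemma bilinear_det_frame_12: "bilinear (\<lambda>u v. det (frame u v a b))"
  by (simp add: bilinear_def linear_iff det_4 frame_def algebra_simps)

lemma inner_transpose_mult:
  fixes A :: "real ^ 'm ^ 'n"
  shows "u \<bullet> (transpose A *v w) = (A *v u) \<bullet> w"
  by (metis dot_lmul_matrix inner_commute transpose_matrix_vector)

lemma bilinear_axis_matrix:
  fixes h :: "real ^ 'n \<Rightarrow> real ^ 'n \<Rightarrow> real" and A :: "real ^ 'm ^ 'n"
  assumes "bilinear h"
  shows "h (A *v u) (A *v v) = u \<bullet> ((transpose A ** (\<chi> i j. h (axis i 1) (axis j 1)) ** A) *v v)"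
proof -
  let ?H = "\<chi> i j. h (axis i 1) (axis j 1)"
  have *: "h u v = u \<bullet> (?H *v v)" for u v
  proof -
    have 1: "linear (\<lambda>u. h u v)" for v
      using assms by (simp add: bilinear_def)
    have 2: "linear (h u)" for u
      using assms by (simp add: bilinear_def)
    show ?thesis
      by (subst linear_axis_expansion[OF 1], subst linear_axis_expansion[OF 2])
        (simp add: inner_vec_def matrix_vector_mult_def mult.commute)
  qed
  show ?thesis
    by (subst *) (simp only: matrix_vector_mul_assoc[symmetric] inner_transpose_mult)
qed

text \<open>Cyclicity of the trace moves \<open>A\<close> from the bivector side to the arguments of
  \<open>h\<close>. This is the mechanism by which coordinate sums become sums over a frame.\<close>

lemma bilinear_contract:
  fixes h :: "real ^ 'n \<Rightarrow> real ^ 'n \<Rightarrow> real" and A :: "real ^ 'm ^ 'n" and b :: "real ^ 'm ^ 'm"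
  assumes "bilinear h"
  shows "(\<Sum>i\<in>UNIV. \<Sum>j\<in>UNIV. (A ** b ** transpose A) $ i $ j * h (axis i 1) (axis j 1)) =
    (\<Sum>i\<in>UNIV. \<Sum>j\<in>UNIV. b $ i $ j * h (A *v axis i 1) (A *v axis j 1))"
proof -
  let ?H = "\<chi> i j. h (axis i 1) (axis j 1)"
  have tr: "(\<Sum>i\<in>UNIV. \<Sum>j\<in>UNIV. M $ i $ j * N $ i $ j) = trace (transpose M ** N)" 
    for M N :: "real ^ 'k ^ 'k"
    by (subst sum.swap) (simp add: trace_def matrix_matrix_mult_def transpose_def)
  have H: "(transpose A ** ?H ** A) $ i $ j = h (A *v axis i 1) (A *v axis j 1)" for i j
    unfolding bilinear_axis_matrix[OF assms]
    by (simp add: inner_axis' matrix_vector_mult_basis column_def)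
  have "trace (transpose (A ** b ** transpose A) ** ?H) = trace (transpose b ** (transpose A ** ?H ** A))"
    using trace_mul_sym[of A "transpose b ** transpose A ** ?H"]
    by (simp add: matrix_transpose_mul matrix_mul_assoc)
  then show ?thesis
    by (simp flip: tr add: H)
qed

lemma wedge_matrix_mult: "wedge (A *v u) (A *v v) = A ** wedge u v ** transpose A"
  by (simp add: vec_eq_iff wedge_def matrix_matrix_mult_def matrix_vector_mult_def transpose_def
      sum_4 algebra_simps)

section \<open>The standard complex structure and anti-self-dual bivectors\<close>

definition std_J :: "real ^ 4 ^ 4" where
  "std_J = vector [vector [0, -1, 0, 0], vector [1, 0, 0, 0], vector [0, 0, 0, -1], vector [0, 0, 1, 0]]"

lemma std_J_mult: "std_J *v u = vector [- u $ 2, u $ 1, - u $ 4, u $ 3]"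
  by (simp add: vec_eq_iff forall_4 std_J_def matrix_vector_mult_def sum_4)

text \<open>Coordinates with respect to \<open>e1 \<and> e2 - e3 \<and> e4\<close>,
  \<open>e1 \<and> e3 + e2 \<and> e4\<close> and \<open>e1 \<and> e4 - e2 \<and> e3\<close>, each of
  squared norm 2 in the inner product of bivectors.\<close>

definition asd :: "real ^ 3 \<Rightarrow> real ^ 4 ^ 4" where
  "asd \<beta> = vector [vector [0, \<beta> $ 1, \<beta> $ 2, \<beta> $ 3], vector [- \<beta> $ 1, 0, - \<beta> $ 3, \<beta> $ 2],
    vector [- \<beta> $ 2, \<beta> $ 3, 0, - \<beta> $ 1], vector [- \<beta> $ 3, - \<beta> $ 2, \<beta> $ 1, 0]]"

definition asd_part :: "real ^ 4 ^ 4 \<Rightarrow> real ^ 3" where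
  "asd_part b = vector [(b $ 1 $ 2 - b $ 3 $ 4) / 2, (b $ 1 $ 3 + b $ 2 $ 4) / 2,
    (b $ 1 $ 4 - b $ 2 $ 3) / 2]"

definition std_hodge :: "real ^ 4 ^ 4 \<Rightarrow> real ^ 4 ^ 4" where
  "std_hodge b = (\<chi> i j. (\<Sum>k\<in>UNIV. \<Sum>l\<in>UNIV. b $ k $ l * levi_civita_symbol i j k l) / 2)"

lemma bivectors_iff: "b \<in> bivectors \<longleftrightarrow> (\<forall>i j. b $ i $ j = - b $ j $ i)"
  by (auto simp: bivectors_def vec_eq_iff transpose_def)

lemma bivector_entries:
  assumes "b \<in> bivectors"
  shows "b $ i $ i = 0" "b $ 2 $ 1 = - b $ 1 $ 2" "b $ 3 $ 1 = - b $ 1 $ 3" "b $ 4 $ 1 = - b $ 1 $ 4"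
    "b $ 3 $ 2 = - b $ 2 $ 3" "b $ 4 $ 2 = - b $ 2 $ 4" "b $ 4 $ 3 = - b $ 3 $ 4"
proof -
  have b: "b $ i $ j = - b $ j $ i" for i j
    by (rule spec[OF spec[OF assms[unfolded bivectors_iff]]])
  show "b $ i $ i = 0" using b[of i i] by linarith
  show "b $ 2 $ 1 = - b $ 1 $ 2" "b $ 3 $ 1 = - b $ 1 $ 3" "b $ 4 $ 1 = - b $ 1 $ 4"
    "b $ 3 $ 2 = - b $ 2 $ 3" "b $ 4 $ 2 = - b $ 2 $ 4" "b $ 4 $ 3 = - b $ 3 $ 4"
    by (rule b)+
qed

text \<open>The star is 1 on the self-dual part and -1 on the anti-self-dual part, so it subtracts
  the latter twice. This form requires no basis of the self-dual part.\<close>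

lemma std_hodge_bivector:
  assumes "b \<in> bivectors"
  shows "std_hodge b = b - 2 *\<^sub>R asd (asd_part b)"
proof -
  note b = bivector_entries[OF assms]
  have det0: "det (frame (axis i 1) (axis i 1) u v) = 0" for i and u v :: "real ^ 4"
    by (rule det_identical_rows[of 1 2]) (simp_all add: frame_def row_def)
  have det1: "det (frame (axis 1 1) (axis 2 1) u v) = u $ 3 * v $ 4 - u $ 4 * v $ 3"
    "det (frame (axis 1 1) (axis 3 1) u v) = u $ 4 * v $ 2 - u $ 2 * v $ 4"
    "det (frame (axis 1 1) (axis 4 1) u v) = u $ 2 * v $ 3 - u $ 3 * v $ 2"
    "det (frame (axis 2 1) (axis 3 1) u v) = u $ 1 * v $ 4 - u $ 4 * v $ 1"
    "det (frame (axis 2 1) (axis 4 1) u v) = u $ 3 * v $ 1 - u $ 1 * v $ 3"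
    "det (frame (axis 3 1) (axis 4 1) u v) = u $ 1 * v $ 2 - u $ 2 * v $ 1"
    "det (frame (axis 2 1) (axis 1 1) u v) = u $ 4 * v $ 3 - u $ 3 * v $ 4"
    "det (frame (axis 3 1) (axis 1 1) u v) = u $ 2 * v $ 4 - u $ 4 * v $ 2"
    "det (frame (axis 4 1) (axis 1 1) u v) = u $ 3 * v $ 2 - u $ 2 * v $ 3"
    "det (frame (axis 3 1) (axis 2 1) u v) = u $ 4 * v $ 1 - u $ 1 * v $ 4"
    "det (frame (axis 4 1) (axis 2 1) u v) = u $ 1 * v $ 3 - u $ 3 * v $ 1"
    "det (frame (axis 4 1) (axis 3 1) u v) = u $ 2 * v $ 1 - u $ 1 * v $ 2"
    for u v :: "real ^ 4"
    by (simp_all add: det_4 frame_def axis_def)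
  have axis: "axis k (1::real) $ i = (if i = k then 1 else 0)" for i k :: 4
    by (simp add: axis_def)
  show ?thesis
    by (simp add: vec_eq_iff forall_4 std_hodge_def levi_civita_symbol_def sum_4 b det0 det1
        asd_def asd_part_def axis) (simp add: diff_divide_distrib add_divide_distrib)
qed

lemma std_hodge_eq_minus_iff:
  assumes "b \<in> bivectors"
  shows "std_hodge b = - b \<longleftrightarrow> b = asd (asd_part b)"
proof -
  have "b - 2 *\<^sub>R a = - b \<longleftrightarrow> b = a" for a
    by (auto simp: vec_eq_iff)
  then show ?thesis unfolding std_hodge_bivector[OF assms] .
qed

lemma asd_part_asd [simp]: "asd_part (asd \<beta>) = \<beta>"
  by (simp add: asd_def asd_part_def vec_eq_iff forall_3)

lemma asd_bivector [simp]: "asd \<beta> \<in> bivectors"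
  by (simp add: asd_def bivectors_iff forall_4)

lemma linear_asd_part: "linear asd_part"
  by (simp add: linear_iff asd_part_def vec_eq_iff forall_3 field_simps)

lemma linear_asd: "linear asd"
  by (simp add: linear_iff asd_def vec_eq_iff forall_4)

text \<open>The divisor 4 has two sources: the sum meets each index pair twice, and the basis
  bivectors have squared norm 2.\<close>

lemma inner_asd_part:
  assumes "c \<in> bivectors"
  shows "\<beta> \<bullet> asd_part c = (\<Sum>i\<in>UNIV. \<Sum>j\<in>UNIV. asd \<beta> $ i $ j * c $ i $ j) / 4"
  by (simp add: sum_4 asd_def asd_part_def inner_vec_def sum_3 bivector_entries[OF assms]
      field_simps)

text \<open>With \<open>z = u1 + i u2\<close> and \<open>w = u3 + i u4\<close>, the entries are
  \<open>|z|^2 - |w|^2\<close> and twice the imaginary and the real part of \<open>z\<close> times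
  the conjugate of \<open>w\<close>.\<close>

definition hopf :: "real ^ 4 \<Rightarrow> real ^ 3" where
  "hopf u = vector [(u$1)\<^sup>2 + (u$2)\<^sup>2 - (u$3)\<^sup>2 - (u$4)\<^sup>2,
     2 * (u$2 * u$3 - u$1 * u$4), 2 * (u$1 * u$3 + u$2 * u$4)]"

lemma inner_hopf: "hopf u \<bullet> hopf u = (u \<bullet> u)\<^sup>2"
  by (simp add: hopf_def inner_vec_def sum_3 sum_4 power2_eq_square algebra_simps)

text \<open>\<open>transpose std_J\<close> is the fundamental form in the standard model. Unit
  length of \<open>u\<close> turns its constant entries into quadratic ones, so that both sides are
  quadratic in \<open>u\<close>.\<close>

lemma wedge_std_J:
  assumes "u \<bullet> u = 1"
  shows "2 *\<^sub>R wedge u (std_J *v u) - transpose std_J = asd (hopf u)"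
proof -
  have "(u$1)\<^sup>2 + (u$2)\<^sup>2 + (u$3)\<^sup>2 + (u$4)\<^sup>2 = 1"
    using assms by (simp add: inner_vec_def sum_4 power2_eq_square)
  then show ?thesis
    unfolding std_J_mult
    by (simp add: vec_eq_iff forall_4 wedge_def transpose_def std_J_def asd_def hopf_def
        power2_eq_square algebra_simps)
qed

text \<open>A common phase of \<open>z\<close> and \<open>w\<close> does not change the Hopf map, so
  the second coordinate can be sought as 0 and the remaining equations solved for \<open>p\<close>,
  then \<open>q\<close> and \<open>r\<close>. For first coordinate -1 this gives
  \<open>p = 0\<close>, hence the separate case.\<close>

lemma hopf_surj:
  assumes "\<beta> \<bullet> \<beta> = 1"
  obtains p q r where "p\<^sup>2 + q\<^sup>2 + r\<^sup>2 = (1::real)" "hopf (vector [p, 0, q, r]) = \<beta>"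
proof -
  have b: "(\<beta>$1)\<^sup>2 + (\<beta>$2)\<^sup>2 + (\<beta>$3)\<^sup>2 = 1"
    using assms by (simp add: inner_vec_def sum_3 power2_eq_square)
  show thesis
  proof (cases "\<beta> $ 1 = -1")
    case True
    then have "\<beta> $ 2 = 0" "\<beta> $ 3 = 0"
      using b by (auto simp: sum_power2_eq_zero_iff)
    with True show thesis
      by (intro that[of 0 1 0]) (simp_all add: hopf_def vec_eq_iff forall_3)
  next
    case False
    have "(\<beta>$1)\<^sup>2 \<le> 1" using b by (smt (verit) zero_le_power2)
    then have "\<beta>$1 > -1" using False abs_square_le_1[of "\<beta>$1"] by linarith
    define p where "p = sqrt ((1 + \<beta>$1) / 2)"
    have p: "p > 0" "p\<^sup>2 = (1 + \<beta>$1) / 2"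
      using \<open>\<beta>$1 > -1\<close> by (auto simp: p_def)
    define q r where "q = \<beta>$3 / (2 * p)" and "r = - \<beta>$2 / (2 * p)"
    have "q\<^sup>2 + r\<^sup>2 = ((\<beta>$2)\<^sup>2 + (\<beta>$3)\<^sup>2) / (4 * p\<^sup>2)"
      by (simp add: q_def r_def power_divide power_mult_distrib add_divide_distrib)
    also have "(\<beta>$2)\<^sup>2 + (\<beta>$3)\<^sup>2 = (1 - \<beta>$1) * (1 + \<beta>$1)"
      using b by (simp add: algebra_simps power2_eq_square)
    also have "\<dots> / (4 * p\<^sup>2) = (1 - \<beta>$1) / 2"
    proof -
      have "4 * p\<^sup>2 = 2 * (1 + \<beta>$1)" by (simp add: p(2))
      then show ?thesis using \<open>\<beta>$1 > -1\<close> by (simp only:) (simp add: divide_eq_eq)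
    qed
    finally have qr: "q\<^sup>2 + r\<^sup>2 = (1 - \<beta>$1) / 2" .
    have "2 * p * q = \<beta>$3" "2 * p * r = - \<beta>$2"
      using p(1) by (simp_all add: q_def r_def)
    then show thesis
      by (intro that[of p q r]) (use p(2) qr in \<open>simp_all add: hopf_def vec_eq_iff forall_3\<close>)
  qed
qed

text \<open>An anti-self-dual matrix is a multiple of an orthogonal one. For this reason a symmetric
  form contracted with it twice leaves only its trace.\<close>

lemma asd_mult_transpose:
  "(\<Sum>j\<in>UNIV. asd \<beta> $ i $ j * asd \<beta> $ k $ j) = (if i = k then \<beta> \<bullet> \<beta> else 0)"
proof -
  have "\<forall>i k. (\<Sum>j\<in>UNIV. asd \<beta> $ i $ j * asd \<beta> $ k $ j) = (if i = k then \<beta> \<bullet> \<beta> else 0)"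
    by (simp add: forall_4 sum_4 asd_def inner_vec_def sum_3 algebra_simps)
  then show ?thesis by blast
qed

text \<open>The Ricci part of the curvature contributes to the anti-self-dual block only through its
  trace.\<close>
lemma asd_kulkarni_nomizu:
  fixes h :: "4 \<Rightarrow> 4 \<Rightarrow> real"
  defines "d \<equiv> \<lambda>i j. if i = j then 1 else 0"
  shows "(\<Sum>i\<in>UNIV. \<Sum>j\<in>UNIV. \<Sum>k\<in>UNIV. \<Sum>l\<in>UNIV. asd \<beta> $ i $ j * asd \<beta> $ k $ l *
    (h i k * d j l + h j l * d i k - h i l * d j k - h j k * d i l)) =
    4 * (\<beta> \<bullet> \<beta>) * (\<Sum>i\<in>UNIV. h i i)"
proof -
  let ?a = "asd \<beta>"
  have skew: "?a $ i $ j = - ?a $ j $ i" for i j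
    by (rule spec[OF spec[OF asd_bivector[unfolded bivectors_iff]]])
  have tr: "(\<Sum>i\<in>UNIV. \<Sum>k\<in>UNIV. \<Sum>j\<in>UNIV. ?a $ i $ j * ?a $ k $ j * h i k) =
      (\<beta> \<bullet> \<beta>) * (\<Sum>i\<in>UNIV. h i i)"
  proof -
    have "(\<Sum>j\<in>UNIV. ?a $ i $ j * ?a $ k $ j * h i k) = (if i = k then (\<beta> \<bullet> \<beta>) * h i k else 0)"
      for i k using asd_mult_transpose[of \<beta> i k] by (simp flip: sum_distrib_right)
    then show ?thesis by (simp add: sum_distrib_left)
  qed
  have t: "(\<Sum>i\<in>UNIV. \<Sum>j\<in>UNIV. \<Sum>k\<in>UNIV. \<Sum>l\<in>UNIV. ?a $ i $ j * ?a $ k $ l * (h i k * d j l))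
      = (\<beta> \<bullet> \<beta>) * (\<Sum>i\<in>UNIV. h i i)"
  proof -
    have "(\<Sum>l\<in>UNIV. ?a $ i $ j * ?a $ k $ l * (h i k * d j l)) = ?a $ i $ j * ?a $ k $ j * h i k"
      for i j k by (simp add: d_def if_distrib cong: if_cong)
    then show ?thesis
      unfolding tr[symmetric] by (simp, intro sum.cong[OF refl] sum.swap)
  qed
  have perm1: "(\<Sum>i\<in>UNIV. \<Sum>j\<in>UNIV. \<Sum>k\<in>UNIV. \<Sum>l\<in>UNIV. f i j k l) =
      (\<Sum>i\<in>UNIV. \<Sum>j\<in>UNIV. \<Sum>k\<in>UNIV. \<Sum>l\<in>UNIV. f j i k l)"
    for f :: "4 \<Rightarrow> 4 \<Rightarrow> 4 \<Rightarrow> 4 \<Rightarrow> real"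
    by (rule sum.swap)
  have perm2: "(\<Sum>i\<in>UNIV. \<Sum>j\<in>UNIV. \<Sum>k\<in>UNIV. \<Sum>l\<in>UNIV. f i j k l) =
      (\<Sum>i\<in>UNIV. \<Sum>j\<in>UNIV. \<Sum>k\<in>UNIV. \<Sum>l\<in>UNIV. f i j l k)"
    for f :: "4 \<Rightarrow> 4 \<Rightarrow> 4 \<Rightarrow> 4 \<Rightarrow> real"
    by (rule sum.cong[OF refl], rule sum.cong[OF refl], rule sum.swap)
  \<comment> \<open>The remaining three terms reduce to \<open>t\<close>: exchanging
    \<open>k\<close> with \<open>l\<close>, or \<open>i\<close> with \<open>j\<close>, costs one
    sign by skew-symmetry, and \<open>t4\<close> costs both.\<close>
  have t2: "(\<Sum>i\<in>UNIV. \<Sum>j\<in>UNIV. \<Sum>k\<in>UNIV. \<Sum>l\<in>UNIV. ?a $ i $ j * ?a $ k $ l * (h i l * d j k))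
      = - ((\<beta> \<bullet> \<beta>) * (\<Sum>i\<in>UNIV. h i i))"
    unfolding t[symmetric] sum_negf[symmetric]
    by (subst perm2) (intro sum.cong[OF refl], subst skew, simp)
  have t3: "(\<Sum>i\<in>UNIV. \<Sum>j\<in>UNIV. \<Sum>k\<in>UNIV. \<Sum>l\<in>UNIV. ?a $ i $ j * ?a $ k $ l * (h j k * d i l))
      = - ((\<beta> \<bullet> \<beta>) * (\<Sum>i\<in>UNIV. h i i))"
    unfolding t[symmetric] sum_negf[symmetric]
    by (subst perm1) (intro sum.cong[OF refl], subst skew, simp)
  have t4: "(\<Sum>i\<in>UNIV. \<Sum>j\<in>UNIV. \<Sum>k\<in>UNIV. \<Sum>l\<in>UNIV. ?a $ i $ j * ?a $ k $ l * (h j l * d i k))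
      = (\<beta> \<bullet> \<beta>) * (\<Sum>i\<in>UNIV. h i i)"
    unfolding t3[symmetric, THEN arg_cong[of _ _ uminus], simplified minus_minus] sum_negf[symmetric]
    by (subst perm2) (intro sum.cong[OF refl], subst skew, simp)
  show ?thesis
    by (simp add: right_diff_distrib distrib_left sum.distrib sum_subtractf t t2 t3 t4)
qed

text \<open>The quadratic form attains its maximum \<open>m\<close> on the compact sphere at some
  \<open>v\<close>. The residual \<open>f v - m *\<^sub>R v\<close> is orthogonal to
  \<open>v\<close>; were it nonzero, a small step along it would push the Rayleigh quotient above
  \<open>m\<close>.\<close>

lemma symmetric_linear_max_eigenvector:
  fixes f :: "'a::euclidean_space \<Rightarrow> 'a"
  assumes "linear f" and sym: "\<And>v w. v \<bullet> f w = f v \<bullet> w"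
  obtains v m where "v \<bullet> v = 1" "f v = m *\<^sub>R v" "\<And>w. w \<bullet> w = 1 \<Longrightarrow> w \<bullet> f w \<le> m"
proof -
  have "continuous_on (sphere 0 1) (\<lambda>w. w \<bullet> f w)"
    using assms(1) by (intro continuous_intros linear_continuous_on) (simp add: linear_conv_bounded_linear)
  moreover have "sphere (0::'a) 1 \<noteq> {}" by simp
  ultimately obtain v where v: "norm v = 1" and max: "\<And>w. norm w = 1 \<Longrightarrow> w \<bullet> f w \<le> v \<bullet> f v"
    using continuous_attains_sup[OF compact_sphere, of "0::'a" 1 "\<lambda>w. w \<bullet> f w"] by auto
  define m where "m = v \<bullet> f v"
  have le: "w \<bullet> f w \<le> m * (w \<bullet> w)" for w
  proof (cases "w = 0")
    case False
    have "(w /\<^sub>R norm w) \<bullet> f (w /\<^sub>R norm w) \<le> m"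
      unfolding m_def using False by (intro max) simp
    then have "(w \<bullet> f w) / (norm w)\<^sup>2 \<le> m"
      by (simp add: linear_cmul[OF assms(1)] power2_eq_square divide_inverse mult_ac)
    then show ?thesis
      using False by (simp add: divide_le_eq power2_norm_eq_inner)
  qed (simp add: linear_0[OF assms(1)])
  define r where "r = f v - m *\<^sub>R v"
  have vv: "v \<bullet> v = 1" using v by (simp add: norm_eq_1)
  have "v \<bullet> r = 0" by (simp add: r_def inner_diff_right m_def vv)
  have "r \<bullet> r = 0"
  proof (rule ccontr)
    assume "r \<bullet> r \<noteq> 0"
    then have pos: "r \<bullet> r > 0" by simp
    define a where "a = r \<bullet> r"
    define b where "b = m * a - r \<bullet> f r"
    have b: "0 \<le> b" using le[of r] by (simp add: b_def a_def)
    \<comment> \<open>The bound \<open>le\<close> at \<open>v + t *\<^sub>R r\<close> sets a gain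
      linear in \<open>t\<close> against a quadratic loss. The choice \<open>t = a / (b + 1)\<close>
      below refutes it; adding 1 avoids division by zero.\<close>
    have "2 * t * a \<le> t\<^sup>2 * b" for t
    proof -
      have "(v + t *\<^sub>R r) \<bullet> f (v + t *\<^sub>R r) = m + 2 * t * (r \<bullet> f v) + t\<^sup>2 * (r \<bullet> f r)"
        using sym[of v r]
        by (simp only: linear_add[OF assms(1)] linear_cmul[OF assms(1)] inner_add_left inner_add_right
            inner_scaleR_left inner_scaleR_right m_def[symmetric] inner_commute[of "f v" r])
          (simp add: power2_eq_square algebra_simps)
      moreover have "(v + t *\<^sub>R r) \<bullet> (v + t *\<^sub>R r) = 1 + t\<^sup>2 * a"
        using \<open>v \<bullet> r = 0\<close>
        by (simp only: inner_add_left inner_add_right inner_scaleR_left inner_scaleR_right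
            inner_commute[of r v] vv a_def) (simp add: power2_eq_square)
      moreover have "r \<bullet> f v = a"
      proof -
        have "r \<bullet> f v = r \<bullet> (r + m *\<^sub>R v)" by (simp add: r_def)
        then show ?thesis
          using \<open>v \<bullet> r = 0\<close> by (simp add: inner_add_right a_def inner_commute[of r v])
      qed
      ultimately show ?thesis
        using le[of "v + t *\<^sub>R r"] unfolding b_def by (simp only:) (simp add: algebra_simps)
    qed
    from this[of "a / (b + 1)"] have "2 * a * a / (b + 1) \<le> a\<^sup>2 * b / (b + 1)\<^sup>2"
      by (simp add: power_divide)
    then have "2 * a * a * (b + 1) \<le> a * a * b"
      using b by (simp add: divide_simps power2_eq_square split: if_splits)
    then have "a * a * (b + 2) \<le> 0" by (simp add: algebra_simps)
    moreover have "a * a * (b + 2) > 0" using pos b by (simp add: a_def)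
    ultimately show False by simp
  qed
  then have "f v = m *\<^sub>R v" by (simp add: r_def)
  moreover have "w \<bullet> f w \<le> m" if "w \<bullet> w = 1" for w using le[of w] that by simp
  ultimately show thesis using that vv by blast
qed

section \<open>Curvature in an adapted frame\<close>

text \<open>Linearity is stated in the third slot, where \<open>riem\<close> has it by inspection;
  the two symmetries carry it to the other slots.\<close>

definition curvature_like ::
  "(real ^ 4 \<Rightarrow> real ^ 4 \<Rightarrow> real ^ 4 \<Rightarrow> real ^ 4 \<Rightarrow> real) \<Rightarrow> bool" where
  "curvature_like T \<longleftrightarrow>
     (\<forall>u v a b. T u v a b = - T v u a b) \<and> (\<forall>u v a b. T u v a b = T a b u v) \<and>
     (\<forall>u v b. linear (\<lambda>a. T u v a b))"

lemma curvature_likeD: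
  assumes "curvature_like T"
  shows "T u v a b = - T v u a b" "T u v a b = T a b u v" "T u v a b = - T u v b a"
    "linear (\<lambda>u. T u v a b)" "linear (\<lambda>v. T u v a b)" "linear (\<lambda>a. T u v a b)" "linear (\<lambda>b. T u v a b)"
proof -
  have 1: "T u v a b = - T v u a b" and 2: "T u v a b = T a b u v" for u v a b
    using assms unfolding curvature_like_def by metis+
  have 3: "linear (\<lambda>a. T u v a b)" for u v b
    using assms unfolding curvature_like_def by metis
  show "T u v a b = - T v u a b" "T u v a b = T a b u v" "linear (\<lambda>a. T u v a b)"
    by (rule 1 2 3)+
  show "T u v a b = - T u v b a"
    using 1[of a b u v] 2[of a b u v] 2[of b a u v] by simp
  show lin1: "linear (\<lambda>u. T u v a b)" for u v a b
    using 3[of a b v] by (subst 2)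
  have 4: "T u v a b = - T u v b a" for u v a b
    using 1[of a b u v] 2[of a b u v] 2[of b a u v] by simp
  show "linear (\<lambda>v. T u v a b)"
    using linear_compose_neg[OF lin1[of u a b]] by (subst 1)
  show "linear (\<lambda>b. T u v a b)"
    using linear_compose_neg[OF 3[of u v a]] by (subst 4)
qed

lemma bilinear_bivector_form: "bilinear (bivector_form T)"
  by (simp add: bilinear_def linear_iff bivector_form_def sum.distrib distrib_left distrib_right
      sum_distrib_left add_divide_distrib mult_ac)

lemma bivector_form_eq:
  "bivector_form T B C = (\<Sum>i\<in>UNIV. \<Sum>j\<in>UNIV. B $ i $ j * (\<Sum>k\<in>UNIV. \<Sum>l\<in>UNIV.
     C $ k $ l * T (axis i 1) (axis j 1) (axis k 1) (axis l 1))) / 4"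
  by (simp add: bivector_form_def sum_distrib_left mult_ac)

lemma bivector_form_commute:
  assumes "curvature_like T"
  shows "bivector_form T B C = bivector_form T C B"
proof -
  let ?f = "\<lambda>i j k l. B $ i $ j * C $ k $ l * T (axis i 1) (axis j 1) (axis k 1) (axis l 1)"
  have "(\<Sum>i\<in>UNIV. \<Sum>j\<in>UNIV. \<Sum>k\<in>UNIV. \<Sum>l\<in>UNIV. ?f i j k l) =
      (\<Sum>i\<in>UNIV. \<Sum>k\<in>UNIV. \<Sum>j\<in>UNIV. \<Sum>l\<in>UNIV. ?f i j k l)"
    by (rule sum.cong[OF refl], rule sum.swap)
  also have "\<dots> = (\<Sum>k\<in>UNIV. \<Sum>i\<in>UNIV. \<Sum>j\<in>UNIV. \<Sum>l\<in>UNIV. ?f i j k l)"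
    by (rule sum.swap)
  also have "\<dots> = (\<Sum>k\<in>UNIV. \<Sum>i\<in>UNIV. \<Sum>l\<in>UNIV. \<Sum>j\<in>UNIV. ?f i j k l)"
    by (rule sum.cong[OF refl], rule sum.cong[OF refl], rule sum.swap)
  also have "\<dots> = (\<Sum>k\<in>UNIV. \<Sum>l\<in>UNIV. \<Sum>i\<in>UNIV. \<Sum>j\<in>UNIV. ?f i j k l)"
    by (rule sum.cong[OF refl], rule sum.swap)
  also have "\<dots> = (\<Sum>k\<in>UNIV. \<Sum>l\<in>UNIV. \<Sum>i\<in>UNIV. \<Sum>j\<in>UNIV.
      C $ k $ l * B $ i $ j * T (axis k 1) (axis l 1) (axis i 1) (axis j 1))"
    by (intro sum.cong refl arg_cong2[where f = "(*)"] curvature_likeD(2)[OF assms] mult.commute)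
  finally show ?thesis
    unfolding bivector_form_def by (simp only:)
qed

lemma bilinear_scaled_sum:
  assumes "\<And>i j. bilinear (h i j)"
  shows "bilinear (\<lambda>u v. \<Sum>i\<in>I. \<Sum>j\<in>K. c i j * h i j u v :: real)"
  using assms unfolding bilinear_def
  by (auto simp: linear_iff sum.distrib distrib_left sum_distrib_left mult_ac)

text \<open>The columns of \<open>E\<close> are the frame vectors: the first matrix equation says
  that they are orthonormal, the second that \<open>J\<close> sends the first to the second and the
  third to the fourth.\<close>

locale adapted_frame = c2_metric G S
  for G :: "real ^ 4 \<Rightarrow> real ^ 4 ^ 4" and S +
  fixes J :: "real ^ 4 \<Rightarrow> real ^ 4 ^ 4" and x :: "real ^ 4" and E :: "real ^ 4 ^ 4"
  assumes x: "x \<in> S"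
    and orthonormal_E: "transpose E ** G x ** E = mat 1"
    and J_E: "J x ** E = E ** std_J"
begin

text \<open>Bivectors are contravariant, so \<open>push b\<close> has components \<open>b\<close> in
  the frame; orthonormality makes \<open>E_inv\<close> the inverse of \<open>E\<close>.\<close>

abbreviation "push b \<equiv> E ** b ** transpose E"
abbreviation "E_inv \<equiv> transpose E ** G x"
abbreviation "e i \<equiv> E *v axis i 1"

lemma E_inv_E: "E_inv ** E = mat 1" and E_E_inv: "E ** E_inv = mat 1"
  using orthonormal_E matrix_left_right_inverse by auto

lemma G_E: "G x ** E = transpose E_inv"
  by (simp add: matrix_transpose_mul G_transpose[OF x])

text \<open>The completeness relation of an orthonormal frame, by which metric traces and raised
  indices become sums over the frame.\<close>

lemma matrix_inv_G: "matrix_inv (G x) = E ** transpose E"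
proof -
  have "G x ** (E ** transpose E) = transpose (E ** E_inv)"
    by (simp add: matrix_mul_assoc matrix_transpose_mul G_transpose[OF x])
  then have "matrix_inv (G x) ** (G x ** (E ** transpose E)) = matrix_inv (G x)"
    by (simp add: E_E_inv)
  then show ?thesis
    by (simp add: matrix_mul_assoc matrix_inv_mult(2)[OF G_invertible[OF x]])
qed

lemma metric_E: "metric G x (E *v a) (E *v b) = a \<bullet> b"
proof -
  have "metric G x (E *v a) (E *v b) = a \<bullet> ((E_inv ** E) *v b)"
    by (simp only: metric_def inner_transpose_mult matrix_vector_mul_assoc[symmetric])
  then show ?thesis by (simp add: E_inv_E)
qed

lemma metric_e: "metric G x (e i) (e j) = (if i = j then 1 else 0)"
  by (simp add: metric_E inner_axis_axis)

lemma transpose_E: "transpose E ** transpose E_inv = mat 1" "transpose E_inv ** transpose E = mat 1"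
  by (simp_all flip: matrix_transpose_mul add: E_inv_E E_E_inv)

lemma unpush_push: "E_inv ** push b ** transpose E_inv = b"
proof -
  have "E_inv ** push b ** transpose E_inv = (E_inv ** E) ** b ** (transpose E ** transpose E_inv)"
    by (simp only: matrix_mul_assoc)
  then show ?thesis by (simp add: E_inv_E transpose_E)
qed

lemma push_unpush: "push (E_inv ** b ** transpose E_inv) = b"
proof -
  have "push (E_inv ** b ** transpose E_inv) = (E ** E_inv) ** b ** (transpose E_inv ** transpose E)"
    by (simp only: matrix_mul_assoc)
  then show ?thesis by (simp add: E_E_inv transpose_E)
qed

lemma push_inject: "push b = push c \<longleftrightarrow> b = c"
  using unpush_push by metis

lemma linear_push: "linear (\<lambda>b. push b)"
  by (simp add: linear_iff vec_eq_iff matrix_matrix_mult_def sum.distrib distrib_left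
      distrib_right sum_distrib_left sum_distrib_right mult_ac)

lemma push_bivector_iff: "push b \<in> bivectors \<longleftrightarrow> b \<in> bivectors"
proof -
  have "transpose (push b) = push (transpose b)"
    by (simp add: matrix_transpose_mul matrix_mul_assoc)
  then show ?thesis
    using linear_neg[OF linear_push, of b] by (simp add: bivectors_def push_inject flip: linear_neg[OF linear_push])
qed

lemma wedge_E: "wedge (E *v u) (E *v v) = push (wedge u v)"
  by (rule wedge_matrix_mult)

lemma raise_eq: "raise G x B = push (transpose E ** B ** E)"
  by (simp add: raise_def matrix_inv_G matrix_mul_assoc)

lemma raise_bilinear:
  assumes "bilinear h"
  shows "raise G x (\<chi> i j. h (axis i 1) (axis j 1)) = push (\<chi> i j. h (e i) (e j))"
  unfolding raise_eq bilinear_axis_matrix[OF assms]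
  by (rule arg_cong[of _ _ push]) (simp add: vec_eq_iff inner_axis' matrix_vector_mult_basis column_def)

lemma bivector_form_push:
  assumes "curvature_like T"
  shows "bivector_form T (push b) (push c) = (\<Sum>i\<in>UNIV. \<Sum>j\<in>UNIV. b $ i $ j *
    (\<Sum>k\<in>UNIV. \<Sum>l\<in>UNIV. c $ k $ l * T (e i) (e j) (e k) (e l))) / 4"
proof -
  have "bilinear (\<lambda>a b. T u v a b)" for u v
    using curvature_likeD(4-7)[OF assms] by (simp add: bilinear_def)
  note 1 = bilinear_contract[OF this]
  have "bilinear (\<lambda>u v. \<Sum>k\<in>UNIV. \<Sum>l\<in>UNIV. c $ k $ l * T u v (e k) (e l))"
    using curvature_likeD(4-7)[OF assms] by (intro bilinear_scaled_sum) (simp add: bilinear_def)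
  note 2 = bilinear_contract[OF this]
  show ?thesis
    unfolding bivector_form_eq 1 2 ..
qed

definition frame_operator ::
  "(real ^ 4 \<Rightarrow> real ^ 4 \<Rightarrow> real ^ 4 \<Rightarrow> real ^ 4 \<Rightarrow> real) \<Rightarrow> real ^ 4 ^ 4 \<Rightarrow> real ^ 4 ^ 4" where
  "frame_operator T b =
     (\<chi> k l. (\<Sum>i\<in>UNIV. \<Sum>j\<in>UNIV. b $ i $ j * T (e i) (e j) (e k) (e l)) / 2)"

lemma bivector_operator_push:
  assumes "curvature_like T"
  shows "bivector_operator G x T (push b) = push (frame_operator T b)"
proof -
  have "bilinear (\<lambda>u v. T u v k l)" for k l
    using curvature_likeD(4-7)[OF assms] by (simp add: bilinear_def)
  note 1 = bilinear_contract[OF this]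
  have "bilinear (\<lambda>u v. (1/2) * (\<Sum>i\<in>UNIV. \<Sum>j\<in>UNIV. b $ i $ j * T (e i) (e j) u v))"
    using curvature_likeD(4-7)[OF assms]
    by (subst sum_distrib_left, subst sum_distrib_left, subst mult.assoc[symmetric], intro bilinear_scaled_sum) (simp add: bilinear_def)
  from raise_bilinear[OF this] show ?thesis
    unfolding bivector_operator_def 1 frame_operator_def by simp
qed

lemma frame_operator_bivector:
  assumes "curvature_like T"
  shows "frame_operator T b \<in> bivectors"
proof -
  have "frame_operator T b $ k $ l = - frame_operator T b $ l $ k" for k l
    by (simp add: frame_operator_def curvature_likeD(3)[OF assms, of _ _ "e k" "e l"] sum_negf)
  then show ?thesis unfolding bivectors_iff by blast
qed

text \<open>The factor 1/2 compensates for \<open>asd\<close> doubling squared norms: the left side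
  uses the Euclidean product of coordinates, the right side the bivectors themselves.\<close>

lemma inner_frame_operator:
  assumes "curvature_like T"
  shows "\<gamma> \<bullet> asd_part (frame_operator T (asd \<beta>)) = bivector_form T (push (asd \<beta>)) (push (asd \<gamma>)) / 2"
proof -
  have "\<gamma> \<bullet> asd_part (frame_operator T (asd \<beta>)) =
      bivector_form T (push (asd \<gamma>)) (push (asd \<beta>)) / 2"
    unfolding inner_asd_part[OF frame_operator_bivector[OF assms]] bivector_form_push[OF assms]
    by (simp add: frame_operator_def curvature_likeD(2)[OF assms] flip: sum_divide_distrib)
  then show ?thesis by (simp add: bivector_form_commute[OF assms])
qed

lemma linear_frame_operator: "linear (frame_operator T)"
  by (simp add: linear_iff frame_operator_def vec_eq_iff sum.distrib distrib_right
      add_divide_distrib sum_distrib_left mult_ac)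

end

section \<open>Sums of curvature-like tensors\<close>

lemma curvature_like_kulkarni_nomizu:
  assumes "bilinear h" "bilinear k" "\<And>u v. h u v = h v u" "\<And>u v. k u v = k v u"
  shows "curvature_like (kulkarni_nomizu h k)"
proof -
  have "kulkarni_nomizu h k u v a b = - kulkarni_nomizu h k v u a b" for u v a b
    by (simp add: kulkarni_nomizu_def)
  moreover have "kulkarni_nomizu h k u v a b = kulkarni_nomizu h k a b u v" for u v a b
    unfolding kulkarni_nomizu_def
    using assms(3)[of a u] assms(3)[of b v] assms(3)[of a v] assms(3)[of b u]
      assms(4)[of a u] assms(4)[of b v] assms(4)[of a v] assms(4)[of b u] by simp
  moreover have "linear (\<lambda>a. kulkarni_nomizu h k u v a b)" for u v b
    using assms(1,2) unfolding kulkarni_nomizu_def bilinear_def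
    by (auto simp: linear_iff algebra_simps)
  ultimately show ?thesis unfolding curvature_like_def by blast
qed

lemma curvature_like_add_scaled:
  assumes "curvature_like T" "curvature_like U"
  shows "curvature_like (\<lambda>u v a b. T u v a b + c * U u v a b)"
proof -
  have "T u v a b + c * U u v a b = - (T v u a b + c * U v u a b)" for u v a b
    using curvature_likeD(1)[OF assms(1), of u v a b] curvature_likeD(1)[OF assms(2), of u v a b]
    by simp
  moreover have "T u v a b + c * U u v a b = T a b u v + c * U a b u v" for u v a b
    using curvature_likeD(2)[OF assms(1), of u v a b] curvature_likeD(2)[OF assms(2), of u v a b]
    by simp
  moreover have "linear (\<lambda>a. T u v a b + c * U u v a b)" for u v b
    using curvature_likeD(6)[OF assms(1), of u v b] curvature_likeD(6)[OF assms(2), of u v b]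
    by (auto simp: linear_iff algebra_simps)
  ultimately show ?thesis unfolding curvature_like_def by blast
qed

lemma bivector_form_add_scaled:
  "bivector_form (\<lambda>u v a b. T u v a b + c * U u v a b) B C =
    bivector_form T B C + c * bivector_form U B C"
  by (simp add: bivector_form_def sum.distrib distrib_left sum_distrib_left add_divide_distrib mult_ac)

section \<open>Ricci, scalar and Weyl curvature in the frame\<close>

context adapted_frame
begin

lemma curvature_like_riem: "curvature_like (riem G x)"
  unfolding curvature_like_def
  using riem_skew riem_pair_sym[OF x] riem_linear3 by blast

lemma curvature_expansion:
  "curvature G x u v w = E *v (\<chi> i. riem G x u v (e i) w)"
proof -
  have "transpose E *v (G x *v curvature G x u v w) = (\<chi> i. riem G x u v (e i) w)"
  proof -
    have "(transpose E *v (G x *v curvature G x u v w)) $ i = riem G x u v (e i) w" for i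
    proof -
      have "(transpose E *v (G x *v curvature G x u v w)) $ i =
          axis i 1 \<bullet> (transpose E *v (G x *v curvature G x u v w))"
        by (simp add: inner_axis')
      also have "\<dots> = metric G x (e i) (curvature G x u v w)"
        by (simp only: metric_def inner_transpose_mult)
      also have "\<dots> = riem G x u v (e i) w"
        unfolding riem_def by (rule metric_sym[OF x])
      finally show ?thesis .
    qed
    then show ?thesis unfolding vec_eq_iff by simp
  qed
  then have "E *v (E_inv *v curvature G x u v w) = E *v (\<chi> i. riem G x u v (e i) w)"
    by (simp only: matrix_vector_mul_assoc)
  then show ?thesis
    by (simp only: matrix_vector_mul_assoc E_E_inv matrix_vector_mul_lid)
qed

text \<open>The coordinate trace of \<open>curvature_expansion\<close> produces entries of
  \<open>E\<close>, which linearity in the first slot absorbs into frame vectors.\<close>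

lemma ricci_eq: "ricci G x u v = (\<Sum>i\<in>UNIV. riem G x (e i) u (e i) v)"
proof -
  have lin: "linear (\<lambda>w. riem G x w u a v)" for a
    by (rule curvature_likeD(4)[OF curvature_like_riem])
  have "ricci G x u v = (\<Sum>k\<in>UNIV. \<Sum>i\<in>UNIV. E $ k $ i * riem G x (axis k 1) u (e i) v)"
    by (simp add: ricci_def curvature_expansion matrix_vector_mult_def)
  also have "\<dots> = (\<Sum>i\<in>UNIV. \<Sum>k\<in>UNIV. E $ k $ i * riem G x (axis k 1) u (e i) v)"
    by (rule sum.swap)
  also have "\<dots> = (\<Sum>i\<in>UNIV. riem G x (e i) u (e i) v)"
  proof (rule sum.cong[OF refl])
    fix i
    have "e i $ k = E $ k $ i" for k
      by (simp add: matrix_vector_mult_basis column_def)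
    then show "(\<Sum>k\<in>UNIV. E $ k $ i * riem G x (axis k 1) u (e i) v) = riem G x (e i) u (e i) v"
      using linear_axis_expansion[OF lin, of "e i" "e i"] by simp
  qed
  finally show ?thesis .
qed

lemma ricci_sym: "ricci G x u v = ricci G x v u"
  unfolding ricci_eq by (rule sum.cong[OF refl], rule riem_pair_sym[OF x])

lemma bilinear_ricci: "bilinear (ricci G x)"
proof -
  have "linear (\<lambda>v. ricci G x u v)" for u
    unfolding ricci_eq
    by (intro linear_compose_sum ballI curvature_likeD(7)[OF curvature_like_riem])
  then show ?thesis
    unfolding bilinear_def using ricci_sym by (metis (no_types, lifting) ext)
qed

lemma bilinear_metric: "bilinear (metric G x)"
  by (simp add: bilinear_def linear_iff metric_def algebra_simps)

lemma scalar_curvature_eq: "scalar_curvature G x = (\<Sum>i\<in>UNIV. ricci G x (e i) (e i))"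
proof -
  have "scalar_curvature G x =
      (\<Sum>i\<in>UNIV. \<Sum>j\<in>UNIV. push (mat 1) $ i $ j * ricci G x (axis i 1) (axis j 1))"
    by (simp add: scalar_curvature_def matrix_inv_G)
  also have "\<dots> = (\<Sum>i\<in>UNIV. \<Sum>j\<in>UNIV. mat 1 $ i $ j * ricci G x (e i) (e j))"
    by (rule bilinear_contract[OF bilinear_ricci])
  also have "\<dots> = (\<Sum>i\<in>UNIV. \<Sum>j\<in>UNIV. if i = j then ricci G x (e i) (e j) else 0)"
    by (intro sum.cong refl) (simp add: mat_def)
  finally show ?thesis by simp
qed

text \<open>Two nested sums of the shape \<open>T + c * U\<close>, to match
  \<open>curvature_like_add_scaled\<close> and \<open>bivector_form_add_scaled\<close>.\<close>

lemma weyl_eq: "weyl G x = (\<lambda>u v a b. (\<lambda>u v a b. riem G x u v a b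
    + (- 1/2) * kulkarni_nomizu (ricci G x) (metric G x) u v a b) u v a b
    + (scalar_curvature G x / 12) * kulkarni_nomizu (metric G x) (metric G x) u v a b)"
  by (simp add: weyl_def fun_eq_iff)

lemma curvature_like_ricci_part: "curvature_like (kulkarni_nomizu (ricci G x) (metric G x))"
  by (intro curvature_like_kulkarni_nomizu bilinear_ricci bilinear_metric ricci_sym metric_sym x)

lemma curvature_like_scalar_part: "curvature_like (kulkarni_nomizu (metric G x) (metric G x))"
  by (intro curvature_like_kulkarni_nomizu bilinear_metric metric_sym x)

lemma curvature_like_weyl: "curvature_like (weyl G x)"
  unfolding weyl_eq
  by (intro curvature_like_add_scaled curvature_like_riem curvature_like_ricci_part
      curvature_like_scalar_part)

lemma bivector_form_kulkarni_nomizu: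
  assumes "curvature_like (kulkarni_nomizu h (metric G x))"
  shows "bivector_form (kulkarni_nomizu h (metric G x)) (push (asd \<beta>)) (push (asd \<beta>)) =
    (\<beta> \<bullet> \<beta>) * (\<Sum>i\<in>UNIV. h (e i) (e i))"
proof -
  have "(\<Sum>i\<in>UNIV. \<Sum>j\<in>UNIV. asd \<beta> $ i $ j * (\<Sum>k\<in>UNIV. \<Sum>l\<in>UNIV. asd \<beta> $ k $ l *
      kulkarni_nomizu h (metric G x) (e i) (e j) (e k) (e l))) =
      4 * (\<beta> \<bullet> \<beta>) * (\<Sum>i\<in>UNIV. h (e i) (e i))"
    unfolding asd_kulkarni_nomizu[of \<beta> "\<lambda>i j. h (e i) (e j)", symmetric]
    by (simp add: kulkarni_nomizu_def metric_e sum_distrib_left mult.assoc)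
  then show ?thesis
    unfolding bivector_form_push[OF assms] by simp
qed

text \<open>The Ricci part has trace \<open>s\<close> and coefficient -1/2, the metric part trace 4
  and coefficient \<open>s / 12\<close>; together they contribute \<open>- s / 6\<close>.\<close>

lemma bivector_form_weyl:
  "bivector_form (weyl G x) (push (asd \<beta>)) (push (asd \<beta>)) =
    bivector_form (riem G x) (push (asd \<beta>)) (push (asd \<beta>)) - scalar_curvature G x / 6 * (\<beta> \<bullet> \<beta>)"
  unfolding weyl_eq bivector_form_add_scaled
    bivector_form_kulkarni_nomizu[OF curvature_like_ricci_part]
    bivector_form_kulkarni_nomizu[OF curvature_like_scalar_part]
  by (simp add: metric_e scalar_curvature_eq[symmetric])

section \<open>Orientation, the Hodge star and the anti-self-dual Weyl operator\<close>

lemma det_E_inv: "sqrt (det (G x)) = \<bar>det E_inv\<bar>" and det_E: "det E * det E_inv = 1"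
proof -
  show *: "det E * det E_inv = 1"
    using arg_cong[OF E_E_inv, of det] by (simp only: det_mul det_I)
  have "G x = transpose E_inv ** E_inv"
    by (metis E_E_inv G_E matrix_mul_assoc matrix_mul_rid)
  then have "det (G x) = det E_inv * det E_inv"
    by (metis det_mul det_transpose)
  then show "sqrt (det (G x)) = \<bar>det E_inv\<bar>"
    by (simp flip: power2_eq_square)
qed

lemma J_E_mult: "J x *v (E *v a) = E *v (std_J *v a)"
  by (simp add: matrix_vector_mul_assoc J_E)

lemma orientation_sign_eq: "orientation_sign J x = sgn (det E_inv)"
proof -
  \<comment> \<open>In complex notation this determinant is the squared modulus of the 2 by 2
    complex determinant of \<open>a\<close> and \<open>b\<close>, so bases of the form
    \<open>a, J a, b, J b\<close> all have the sign of \<open>det E\<close>.\<close>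
  have nonneg: "det (frame a (std_J *v a) b (std_J *v b)) \<ge> 0" for a b
  proof -
    have "det (frame a (std_J *v a) b (std_J *v b)) =
      (a$1 * b$3 - a$2 * b$4 - a$3 * b$1 + a$4 * b$2)\<^sup>2 + (a$1 * b$4 + a$2 * b$3 - a$3 * b$2 - a$4 * b$1)\<^sup>2"
      by (simp add: det_4 frame_def std_J_mult power2_eq_square algebra_simps)
    then show ?thesis by simp
  qed
  have "(\<exists>u v. det (frame u (J x *v u) v (J x *v v)) > 0) \<longleftrightarrow> det E > 0"
  proof
    assume "\<exists>u v. det (frame u (J x *v u) v (J x *v v)) > 0"
    then obtain u v where "det (frame u (J x *v u) v (J x *v v)) > 0" by blast
    moreover have "E *v (E_inv *v w) = w" for w
      by (simp only: matrix_vector_mul_assoc E_E_inv matrix_vector_mul_lid)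
    ultimately have "det (frame (E *v (E_inv *v u)) (E *v (std_J *v (E_inv *v u)))
        (E *v (E_inv *v v)) (E *v (std_J *v (E_inv *v v)))) > 0"
      by (simp only: J_E_mult[symmetric])
    then show "det E > 0"
      unfolding det_frame_mult using nonneg by (smt (verit) mult_nonpos_nonneg)
  next
    assume "det E > 0"
    moreover have "det (frame (axis 1 1) (std_J *v axis 1 1) (axis 3 1) (std_J *v axis 3 1)) = 1"
      by (simp add: det_4 frame_def std_J_mult axis_def)
    ultimately have "det (frame (e 1) (J x *v e 1) (e 3) (J x *v e 3)) > 0"
      unfolding J_E_mult det_frame_mult by simp
    then show "\<exists>u v. det (frame u (J x *v u) v (J x *v v)) > 0" by blast
  qed
  moreover have "det E > 0 \<longleftrightarrow> det E_inv > 0" "det E_inv \<noteq> 0"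
    using det_E by (smt (verit) zero_less_mult_iff, force)
  ultimately show ?thesis
    by (simp add: orientation_sign_def sgn_if)
qed

text \<open>The permutation symbol is a tensor only up to the factor \<open>det E_inv\<close>. The
  prefactor of \<open>hodge_star\<close> is half the sign of that determinant over its modulus and
  cancels the factor.\<close>

lemma hodge_star_push: "hodge_star G J x (push b) = push (std_hodge b)"
proof -
  let ?A = "transpose E_inv"
  define k where "k p q = (\<Sum>i\<in>UNIV. \<Sum>j\<in>UNIV. b $ i $ j * det (frame p q (axis i 1) (axis j 1)))" for p q
  have k: "bilinear k"
    unfolding k_def by (intro bilinear_scaled_sum bilinear_det_frame_12)
  have lower: "lower G x (push b) = ?A ** b ** transpose ?A"
    unfolding lower_def by (simp only: matrix_mul_assoc G_E transpose_transpose)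
  \<comment> \<open>With the free coordinate vectors also written as images under \<open>?A\<close>,
    all four rows share the map and its determinant factors out.\<close>
  have A: "axis i 1 = ?A *v (transpose E *v axis i 1)" for i
    by (simp only: matrix_vector_mul_assoc transpose_E matrix_vector_mul_lid)
  have "(\<Sum>m\<in>UNIV. \<Sum>n\<in>UNIV. levi_civita_symbol i j m n * lower G x (push b) $ m $ n) =
      det E_inv * k (transpose E *v axis i 1) (transpose E *v axis j 1)" for i j
  proof -
    have "(\<Sum>m\<in>UNIV. \<Sum>n\<in>UNIV. levi_civita_symbol i j m n * lower G x (push b) $ m $ n) =
       (\<Sum>m\<in>UNIV. \<Sum>n\<in>UNIV. b $ m $ n *
         det (frame (axis i 1) (axis j 1) (?A *v axis m 1) (?A *v axis n 1)))"
      unfolding lower levi_civita_symbol_def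
      by (subst bilinear_contract[OF bilinear_det_frame_34, symmetric]) (simp only: mult.commute)
    also have "\<dots> = (\<Sum>m\<in>UNIV. \<Sum>n\<in>UNIV. b $ m $ n * (det E_inv *
        det (frame (transpose E *v axis i 1) (transpose E *v axis j 1) (axis m 1) (axis n 1))))"
      by (subst A[of i], subst A[of j]) (simp only: det_frame_mult det_transpose)
    finally show ?thesis
      by (simp add: k_def sum_distrib_left mult_ac)
  qed
  moreover have "k (transpose E *v axis i 1) (transpose E *v axis j 1) = 2 * push (std_hodge b) $ i $ j"
    for i j
  proof -
    have "(\<chi> i j. k (axis i 1) (axis j 1)) = 2 *\<^sub>R std_hodge b"
      by (simp add: vec_eq_iff std_hodge_def k_def levi_civita_symbol_def)
    then have "k (transpose E *v axis i 1) (transpose E *v axis j 1) =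
        axis i 1 \<bullet> (push (2 *\<^sub>R std_hodge b) *v axis j 1)"
      unfolding bilinear_axis_matrix[OF k] by simp
    then show ?thesis
      by (simp add: linear_cmul[OF linear_push] inner_axis' matrix_vector_mult_basis column_def)
  qed
  moreover have "orientation_sign J x / (2 * sqrt (det (G x))) * (det E_inv * (2 * r)) = r" for r
  proof -
    have "det E_inv \<noteq> 0" using det_E by auto
    then show ?thesis by (simp add: det_E_inv orientation_sign_eq sgn_if)
  qed
  ultimately show ?thesis
    by (simp add: hodge_star_def vec_eq_iff)
qed

lemma Lambda_minus_eq: "Lambda_minus G J x = range (\<lambda>\<beta>. push (asd \<beta>))"
proof -
  have *: "push b \<in> Lambda_minus G J x \<longleftrightarrow> b \<in> range asd" for b
  proof -
    have "push b \<in> Lambda_minus G J x \<longleftrightarrow> b \<in> bivectors \<and> std_hodge b = - b"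
      by (simp add: Lambda_minus_def hodge_star_push push_bivector_iff push_inject
          flip: linear_neg[OF linear_push])
    also have "\<dots> \<longleftrightarrow> b \<in> range asd"
    proof
      assume "b \<in> bivectors \<and> std_hodge b = - b"
      then have "b = asd (asd_part b)" using std_hodge_eq_minus_iff by blast
      then show "b \<in> range asd" by (rule range_eqI)
    next
      assume "b \<in> range asd"
      then show "b \<in> bivectors \<and> std_hodge b = - b"
        by (auto simp: std_hodge_eq_minus_iff)
    qed
    finally show ?thesis .
  qed
  have "B \<in> Lambda_minus G J x \<longleftrightarrow> B \<in> (\<lambda>b. push b) ` range asd" for B
  proof
    assume "B \<in> Lambda_minus G J x"
    then have "E_inv ** B ** transpose E_inv \<in> range asd"
      by (subst *[symmetric]) (simp only: push_unpush)
    then show "B \<in> (\<lambda>b. push b) ` range asd"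
      by (rule rev_image_eqI) (simp only: push_unpush)
  qed (use * in blast)
  then show ?thesis by (auto simp: image_image)
qed

definition asd_weyl :: "real ^ 3 \<Rightarrow> real ^ 3" where
  "asd_weyl \<beta> = asd_part (frame_operator (weyl G x) (asd \<beta>))"

text \<open>Half of \<open>c - std_hodge c\<close> is the anti-self-dual projection of
  \<open>c\<close>, by \<open>std_hodge_bivector\<close>. Thus \<open>asd_weyl\<close> is the Weyl
  block read in coordinates of R^3.\<close>

lemma W_minus_push: "W_minus G J x (push (asd \<beta>)) = push (asd (asd_weyl \<beta>))"
proof -
  let ?c = "frame_operator (weyl G x) (asd \<beta>)"
  have "(1/2) *\<^sub>R (push ?c - push (std_hodge ?c)) = push ((1/2) *\<^sub>R (?c - std_hodge ?c))"
    by (simp only: linear_cmul[OF linear_push] linear_diff[OF linear_push])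
  also have "(1/2) *\<^sub>R (?c - std_hodge ?c) = asd (asd_weyl \<beta>)"
    by (simp add: std_hodge_bivector frame_operator_bivector curvature_like_weyl asd_weyl_def)
  finally show ?thesis
    by (simp add: W_minus_def Let_def bivector_operator_push[OF curvature_like_weyl] hodge_star_push)
qed

lemma linear_asd_weyl: "linear asd_weyl"
  using linear_compose[OF linear_compose[OF linear_asd linear_frame_operator] linear_asd_part]
  by (simp add: o_def asd_weyl_def[abs_def])

lemma asd_weyl_sym: "\<gamma> \<bullet> asd_weyl \<beta> = asd_weyl \<gamma> \<bullet> \<beta>"
  by (simp add: asd_weyl_def inner_frame_operator[OF curvature_like_weyl]
      inner_commute[of _ \<beta>] bivector_form_commute[OF curvature_like_weyl, of _ "push (asd \<beta>)"])

lemma inner_asd_weyl: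
  "\<beta> \<bullet> asd_weyl \<beta> = bivector_form (riem G x) (push (asd \<beta>)) (push (asd \<beta>)) / 2
    - scalar_curvature G x / 12 * (\<beta> \<bullet> \<beta>)"
  by (simp add: asd_weyl_def inner_frame_operator[OF curvature_like_weyl] bivector_form_weyl
      diff_divide_distrib)

section \<open>The fundamental form and the orthogonal holomorphic sectional curvature\<close>

lemma omega_eq: "omega G J x = push (transpose std_J)"
proof -
  have "bilinear (\<lambda>u v. metric G x (J x *v u) v)"
    by (simp add: bilinear_def linear_iff metric_def algebra_simps)
  from raise_bilinear[OF this] have "omega G J x = push (\<chi> i j. (std_J *v axis i 1) \<bullet> axis j 1)"
    by (simp add: omega_def J_E_mult metric_E)
  also have "(\<chi> i j. (std_J *v axis i 1) \<bullet> axis j 1) = transpose std_J"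
    by (simp add: vec_eq_iff inner_axis matrix_vector_mult_basis column_def transpose_def)
  finally show ?thesis .
qed

text \<open>The left side does not mention the frame, so this sum of wedges is the same for every
  adapted frame.\<close>

lemma omega_wedge: "omega G J x = wedge (e 1) (e 2) + wedge (e 3) (e 4)"
proof -
  have "transpose std_J = wedge (axis 1 1) (axis 2 1) + wedge (axis 3 1) (axis 4 1)"
    by (simp add: vec_eq_iff forall_4 transpose_def std_J_def wedge_def axis_def)
  then show ?thesis
    by (simp add: omega_eq wedge_E linear_add[OF linear_push])
qed

text \<open>The vector \<open>Y\<close> enters only through its wedge with \<open>J Y\<close>, which
  is the fundamental form minus that of \<open>X\<close>. The cross terms cancel; the fundamental
  form gives \<open>s_star / 8\<close>, the anti-self-dual bivector \<open>s / 24\<close> and half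
  the Weyl term.\<close>

lemma H_ohol_eq:
  assumes u: "u \<bullet> u = 1"
    and Y: "wedge (E *v u) (J x *v (E *v u)) + wedge Y (J x *v Y) = omega G J x"
  shows "H_ohol G J x (E *v u) Y = (scalar_curvature G x + 3 * star_scalar_curvature G J x) / 24
    + (hopf u \<bullet> asd_weyl (hopf u)) / 2"
proof -
  let ?F = "bivector_form (riem G x)"
  let ?w = "omega G J x" and ?a = "push (asd (hopf u))"
  have lin: "linear (\<lambda>B. ?F B C)" "linear (?F C)" for C
    using bilinear_bivector_form[of "riem G x"] by (simp_all add: bilinear_def)
  have a: "?a = 2 *\<^sub>R wedge (E *v u) (J x *v (E *v u)) - ?w"
    by (simp add: J_E_mult wedge_E omega_eq linear_cmul[OF linear_push] linear_diff[OF linear_push]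
        flip: wedge_std_J[OF u])
  have X: "wedge (E *v u) (J x *v (E *v u)) = (1/2) *\<^sub>R (?w + ?a)"
    unfolding a by simp
  have Y: "wedge Y (J x *v Y) = (1/2) *\<^sub>R (?w - ?a)"
    using Y unfolding a by (simp add: algebra_simps)
  have "hopf u \<bullet> hopf u = 1" by (simp add: inner_hopf u)
  then have "?F ?a ?a = 2 * (hopf u \<bullet> asd_weyl (hopf u)) + scalar_curvature G x / 6"
    by (simp add: inner_asd_weyl)
  moreover have "H_ohol G J x (E *v u) Y = (?F ?w ?w + ?F ?a ?a) / 4"
    unfolding H_ohol_def X Y linear_cmul[OF lin(1)] linear_cmul[OF lin(2)]
      linear_add[OF lin(1)] linear_add[OF lin(2)] linear_diff[OF lin(1)] linear_diff[OF lin(2)]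
    by (simp add: field_simps)
  ultimately show ?thesis
    by (simp add: star_scalar_curvature_def field_simps)
qed

end

section \<open>Extrema of the orthogonal holomorphic sectional curvature\<close>

lemma orthonormal_4_iff:
  assumes "\<And>u v. metric G x u v = metric G x v u"
  shows "orthonormal G x [a, b, c, d] \<longleftrightarrow>
    metric G x a a = 1 \<and> metric G x b b = 1 \<and> metric G x c c = 1 \<and> metric G x d d = 1 \<and>
    metric G x a b = 0 \<and> metric G x a c = 0 \<and> metric G x a d = 0 \<and>
    metric G x b c = 0 \<and> metric G x b d = 0 \<and> metric G x c d = 0"
  unfolding orthonormal_def
  using assms[of b a] assms[of c a] assms[of d a] assms[of c b] assms[of d b] assms[of d c]
  by (auto simp: All_less_Suc)

text \<open>The transpose turns the rows of \<open>frame\<close> into the columns that the locale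
  expects. The second and fourth columns of the equation for \<open>J\<close> use that
  \<open>J\<close> squares to -1.\<close>

lemma (in c2_metric) adapted_frameI:
  assumes x: "x \<in> S" and J: "\<And>v. J x *v (J x *v v) = - v"
    and orth: "orthonormal G x [X, J x *v X, Y, J x *v Y]"
  shows "adapted_frame G S J x (transpose (frame X (J x *v X) Y (J x *v Y)))"
proof -
  let ?E = "transpose (frame X (J x *v X) Y (J x *v Y))"
  have e: "?E *v axis 1 1 = X" "?E *v axis 2 1 = J x *v X" "?E *v axis 3 1 = Y"
    "?E *v axis 4 1 = J x *v Y"
    by (simp_all add: matrix_vector_mult_basis column_def transpose_def frame_def vec_eq_iff)
  note o = orth[unfolded orthonormal_4_iff[OF metric_sym[OF x]]]
  have sym0: "metric G x b a = 0" if "metric G x a b = 0" for a b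
    using metric_sym[OF x, of a b] that by simp
  have o': "metric G x (J x *v X) X = 0" "metric G x Y X = 0" "metric G x (J x *v Y) X = 0"
    "metric G x Y (J x *v X) = 0" "metric G x (J x *v Y) (J x *v X) = 0"
    "metric G x (J x *v Y) Y = 0"
    by (rule sym0, use o in blast)+
  have "metric G x (?E *v axis i 1) (?E *v axis j 1) = (if i = j then 1 else 0)" for i j
  proof -
    have "\<forall>i j. metric G x (?E *v axis i 1) (?E *v axis j 1) = (if i = j then 1 else 0)"
      unfolding forall_4 e by (simp add: o o')
    then show ?thesis by blast
  qed
  moreover have "(transpose ?E ** G x ** ?E) $ i $ j = metric G x (?E *v axis i 1) (?E *v axis j 1)"
    for i j
  proof -
    have "(transpose ?E ** G x ** ?E) $ i $ j = axis i 1 \<bullet> ((transpose ?E ** G x ** ?E) *v axis j 1)"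
      by (simp add: inner_axis' matrix_vector_mult_basis column_def)
    then show ?thesis
      by (simp only: metric_def inner_transpose_mult matrix_vector_mul_assoc[symmetric])
  qed
  ultimately have "transpose ?E ** G x ** ?E = mat 1"
    by (simp add: vec_eq_iff mat_def)
  moreover have "(J x ** ?E) *v axis i 1 = (?E ** std_J) *v axis i 1" for i
  proof -
    have std_J_axis: "std_J *v axis 1 1 = axis 2 1" "std_J *v axis 2 1 = - axis 1 1"
      "std_J *v axis 3 1 = axis 4 1" "std_J *v axis 4 1 = - axis 3 1"
      by (simp_all add: std_J_mult vec_eq_iff forall_4 axis_def)
    have "\<forall>i. J x *v (?E *v axis i 1) = ?E *v (std_J *v axis i 1)"
      unfolding forall_4 std_J_axis linear_neg[OF matrix_vector_mul_linear] e J
      by (intro conjI refl)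
    then show ?thesis by (simp only: matrix_vector_mul_assoc)
  qed
  then have "J x ** ?E = ?E ** std_J"
    by (simp add: matrix_vector_mult_basis column_def vec_eq_iff)
  ultimately show ?thesis
    using x by unfold_locales
qed

lemma (in c2_metric) exists_adapted_basis:
  assumes x: "x \<in> S" and J: "\<And>v. J x *v (J x *v v) = - v"
    and JJ: "\<And>u v. metric G x (J x *v u) (J x *v v) = metric G x u v"
  obtains X Y where "orthonormal G x [X, J x *v X, Y, J x *v Y]"
proof -
  have scale: "metric G x (a *\<^sub>R u) (b *\<^sub>R v) = a * b * metric G x u v" for a b u v
    by (simp add: metric_def matrix_vector_mult_scaleR)
  have neg: "metric G x u (- v) = - metric G x u v" for u v
    using scale[of 1 u "-1" v] by simp
  have unit: "\<exists>a. metric G x (a *\<^sub>R v) (a *\<^sub>R v) = 1" if "v \<noteq> 0" for v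
    using metric_pos[OF x that]
    by (intro exI[of _ "1 / sqrt (metric G x v v)"]) (simp add: scale)
  have J0: "metric G x v (J x *v v) = 0" for v
  proof -
    have "metric G x v (J x *v v) = metric G x (J x *v v) (- v)"
      using JJ[of v "J x *v v"] by (simp only: J)
    then show ?thesis
      using metric_sym[OF x, of v "J x *v v"] unfolding neg by simp
  qed
  have "axis 1 1 \<noteq> (0 :: real ^ 4)" by (simp add: axis_eq_0_iff)
  then obtain X where X: "metric G x X X = 1" using unit by blast
  \<comment> \<open>Being orthogonal to \<open>G x *v z\<close> in the Euclidean sense is being
    orthogonal to \<open>z\<close> in the metric, so a nonzero \<open>y\<close> is sought outside
    the span of two vectors.\<close>
  have "dim {G x *v X, G x *v (J x *v X)} < DIM(real ^ 4)"
  proof -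
    have "dim {G x *v X, G x *v (J x *v X)} \<le> card {G x *v X, G x *v (J x *v X)}"
      by (simp add: dim_le_card')
    also have "\<dots> \<le> 2" using card_2_iff' by (simp add: card_insert_if)
    finally show ?thesis by simp
  qed
  then obtain y where y: "y \<noteq> 0"
    "\<And>z. z \<in> span {G x *v X, G x *v (J x *v X)} \<Longrightarrow> orthogonal y z"
    using orthogonal_to_subspace_exists by blast
  obtain a where a: "metric G x (a *\<^sub>R y) (a *\<^sub>R y) = 1" using unit[OF y(1)] by blast
  define Y where "Y = a *\<^sub>R y"
  have YX: "metric G x Y X = 0" "metric G x Y (J x *v X) = 0"
    using y(2)[of "G x *v X"] y(2)[of "G x *v (J x *v X)"]
    by (simp_all add: span_base orthogonal_def Y_def metric_def)
  have XY: "metric G x X Y = 0" "metric G x (J x *v X) Y = 0"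
    using YX metric_sym[OF x, of Y X] metric_sym[OF x, of Y "J x *v X"] by simp_all
  have "metric G x X (J x *v Y) = metric G x (J x *v X) (- Y)"
    using JJ[of X "J x *v Y"] by (simp only: J)
  then have "metric G x X (J x *v Y) = 0"
    by (simp add: neg XY)
  then have "orthonormal G x [X, J x *v X, Y, J x *v Y]"
    unfolding orthonormal_4_iff[OF metric_sym[OF x]]
    using X a XY by (simp add: J0 JJ flip: Y_def)
  then show thesis by (rule that)
qed

section \<open>The curvature values as a quadratic form on the unit sphere of R^3\<close>

context adapted_frame
begin

lemma J_J: "J x *v (J x *v v) = - v"
proof -
  have v: "v = E *v (E_inv *v v)"
    by (simp only: matrix_vector_mul_assoc E_E_inv matrix_vector_mul_lid)
  have "std_J *v (std_J *v w) = - w" for w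
    by (simp add: std_J_mult vec_eq_iff forall_4)
  then have "J x *v (J x *v (E *v (E_inv *v v))) = - (E *v (E_inv *v v))"
    by (simp only: J_E_mult) (simp add: linear_neg)
  then show ?thesis by (simp flip: v)
qed

abbreviation "H_base \<equiv> (scalar_curvature G x + 3 * star_scalar_curvature G J x) / 24"

lemma H_ohol_orthonormal:
  assumes orth: "orthonormal G x [E *v u, J x *v (E *v u), Y, J x *v Y]"
  shows "u \<bullet> u = 1" "H_ohol G J x (E *v u) Y = H_base + (hopf u \<bullet> asd_weyl (hopf u)) / 2"
proof -
  show u: "u \<bullet> u = 1"
    using orth unfolding orthonormal_4_iff[OF metric_sym[OF x]] by (simp add: metric_E)
  \<comment> \<open>The basis at hand yields a second adapted frame; its \<open>omega_wedge\<close>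
    supplies the relation between the two wedges required by \<open>H_ohol_eq\<close>.\<close>
  interpret F: adapted_frame G S J x "transpose (frame (E *v u) (J x *v (E *v u)) Y (J x *v Y))"
    using adapted_frameI[where J = J and x = x, OF x J_J orth] .
  show "H_ohol G J x (E *v u) Y = H_base + (hopf u \<bullet> asd_weyl (hopf u)) / 2"
    by (intro H_ohol_eq u)
      (simp add: F.omega_wedge matrix_vector_mult_basis column_def transpose_def frame_def)
qed

lemma H_ohol_values_eq:
  "H_ohol_values G J x = {H_base + (\<beta> \<bullet> asd_weyl \<beta>) / 2 | \<beta>. \<beta> \<bullet> \<beta> = 1}"
proof (intro equalityI subsetI)
  fix h assume "h \<in> H_ohol_values G J x"
  then obtain X Y where h: "h = H_ohol G J x X Y" "orthonormal G x [X, J x *v X, Y, J x *v Y]"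
    unfolding H_ohol_values_def by blast
  define u where "u = E_inv *v X"
  have "X = E *v u"
    unfolding u_def by (simp only: matrix_vector_mul_assoc E_E_inv matrix_vector_mul_lid)
  with H_ohol_orthonormal[of u Y] h inner_hopf[of u]
  show "h \<in> {H_base + (\<beta> \<bullet> asd_weyl \<beta>) / 2 | \<beta>. \<beta> \<bullet> \<beta> = 1}"
    by (intro CollectI exI[of _ "hopf u"]) simp
next
  fix h assume "h \<in> {H_base + (\<beta> \<bullet> asd_weyl \<beta>) / 2 | \<beta>. \<beta> \<bullet> \<beta> = 1}"
  then obtain \<beta> where h: "h = H_base + (\<beta> \<bullet> asd_weyl \<beta>) / 2" and "\<beta> \<bullet> \<beta> = 1" by blast
  then obtain p q r where pqr: "p\<^sup>2 + q\<^sup>2 + r\<^sup>2 = 1" "hopf (vector [p, 0, q, r]) = \<beta>"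
    using hopf_surj by blast
  \<comment> \<open>In complex notation the first vector is \<open>(z, w)\<close> with
    \<open>z = p\<close> and \<open>w = q + i r\<close>, and its partner is minus the conjugate of
    \<open>w\<close> followed by the conjugate of \<open>z\<close>.\<close>
  have "orthonormal G x [E *v vector [p, 0, q, r], J x *v (E *v vector [p, 0, q, r]),
      E *v vector [- q, r, p, 0], J x *v (E *v vector [- q, r, p, 0])]"
    using pqr(1) unfolding orthonormal_4_iff[OF metric_sym[OF x]] J_E_mult metric_E
    by (simp add: std_J_mult inner_vec_def sum_4 power2_eq_square algebra_simps)
  with H_ohol_orthonormal(2)[OF this] show "h \<in> H_ohol_values G J x"
    unfolding H_ohol_values_def pqr(2) h by (metis (mono_tags, lifting) mem_Collect_eq)
qed

text \<open>A value occurs in the list exactly when its eigenspace has nonzero dimension. The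
  injective map \<open>push\<close> after \<open>asd\<close> carries eigenvectors of
  \<open>asd_weyl\<close> to those of \<open>W_minus\<close>, and scaling makes them unit
  vectors.\<close>

lemma eigenvalues_on_asd_weyl:
  assumes "eigenvalues_on (Lambda_minus G J x) (W_minus G J x) ls"
  shows "t \<in> set ls \<longleftrightarrow> (\<exists>\<beta>. \<beta> \<bullet> \<beta> = 1 \<and> asd_weyl \<beta> = t *\<^sub>R \<beta>)"
proof -
  let ?V = "{v \<in> Lambda_minus G J x. W_minus G J x v = t *\<^sub>R v}"
  have push: "linear (\<lambda>\<beta>. push (asd \<beta>))"
    using linear_compose[OF linear_asd linear_push] by (simp add: o_def)
  have asd_inject: "push (asd \<beta>) = push (asd \<gamma>) \<longleftrightarrow> \<beta> = \<gamma>" for \<beta> \<gamma>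
    by (metis push_inject asd_part_asd)
  have "t \<in> set ls \<longleftrightarrow> count (mset ls) t \<noteq> 0"
    by (metis count_eq_zero_iff set_mset_mset)
  also have "\<dots> \<longleftrightarrow> \<not> ?V \<subseteq> {0}"
    using assms unfolding eigenvalues_on_def by simp
  also have "\<dots> \<longleftrightarrow> (\<exists>\<beta>. \<beta> \<noteq> 0 \<and> asd_weyl \<beta> = t *\<^sub>R \<beta>)"
  proof -
    have "push (asd \<beta>) = 0 \<longleftrightarrow> \<beta> = 0" for \<beta>
      using asd_inject[of \<beta> 0] linear_0[OF push] by simp
    moreover have "W_minus G J x (push (asd \<beta>)) = t *\<^sub>R push (asd \<beta>) \<longleftrightarrow> asd_weyl \<beta> = t *\<^sub>R \<beta>" for \<beta>
      unfolding W_minus_push using asd_inject[of "asd_weyl \<beta>" "t *\<^sub>R \<beta>"] linear_cmul[OF push, of t \<beta>]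
      by simp
    ultimately show ?thesis
      unfolding Lambda_minus_eq by blast
  qed
  also have "\<dots> \<longleftrightarrow> (\<exists>\<beta>. \<beta> \<bullet> \<beta> = 1 \<and> asd_weyl \<beta> = t *\<^sub>R \<beta>)"
  proof
    assume "\<exists>\<beta>. \<beta> \<noteq> 0 \<and> asd_weyl \<beta> = t *\<^sub>R \<beta>"
    then obtain \<beta> where "\<beta> \<noteq> 0" "asd_weyl \<beta> = t *\<^sub>R \<beta>" by blast
    moreover from this have "(\<beta> /\<^sub>R norm \<beta>) \<bullet> (\<beta> /\<^sub>R norm \<beta>) = 1"
      unfolding norm_eq_1[symmetric] by simp
    moreover have "asd_weyl (\<beta> /\<^sub>R norm \<beta>) = t *\<^sub>R (\<beta> /\<^sub>R norm \<beta>)"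
      by (simp add: linear_cmul[OF linear_asd_weyl] \<open>asd_weyl \<beta> = t *\<^sub>R \<beta>\<close>)
    ultimately show "\<exists>\<beta>. \<beta> \<bullet> \<beta> = 1 \<and> asd_weyl \<beta> = t *\<^sub>R \<beta>" by blast
  qed (metis inner_zero_left zero_neq_one)
  finally show ?thesis .
qed

lemma H_ohol_extrema:
  assumes "l1 \<le> l2" "l2 \<le> l3"
    and eig: "eigenvalues_on (Lambda_minus G J x) (W_minus G J x) [l1, l2, l3]"
  shows "is_maximum (H_ohol_values G J x) (H_base + l3 / 2)"
    and "is_minimum (H_ohol_values G J x) (H_base + l1 / 2)"
proof -
  note eig = eigenvalues_on_asd_weyl[OF eig]
  obtain v m where v: "v \<bullet> v = 1" "asd_weyl v = m *\<^sub>R v"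
    and m: "\<And>w. w \<bullet> w = 1 \<Longrightarrow> w \<bullet> asd_weyl w \<le> m"
    using symmetric_linear_max_eigenvector[OF linear_asd_weyl asd_weyl_sym] by blast
  \<comment> \<open>The maximum \<open>m\<close> is an eigenvalue, hence in the list and at most
    \<open>l3\<close>; a unit eigenvector for \<open>l3\<close> gives the form the value
    \<open>l3\<close>, hence the converse.\<close>
  have "m = l3"
  proof (rule antisym)
    show "m \<le> l3" using eig[of m] v assms(1,2) by auto
    show "l3 \<le> m" using eig[of l3] m by fastforce
  qed
  then have "v \<bullet> asd_weyl v = l3" using v by simp
  then show "is_maximum (H_ohol_values G J x) (H_base + l3 / 2)"
    unfolding is_maximum_def H_ohol_values_eq using v m \<open>m = l3\<close> by force
  \<comment> \<open>The minimum is the maximum for the negated operator, whose largest eigenvalue is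
    \<open>- l1\<close>.\<close>
  have neg_sym: "v \<bullet> - asd_weyl w = - asd_weyl v \<bullet> w" for v w
    using asd_weyl_sym[of v w] by simp
  obtain v m where v: "v \<bullet> v = 1" "- asd_weyl v = m *\<^sub>R v"
    and m: "\<And>w. w \<bullet> w = 1 \<Longrightarrow> w \<bullet> - asd_weyl w \<le> m"
    using symmetric_linear_max_eigenvector[OF linear_compose_neg[OF linear_asd_weyl] neg_sym] by blast
  then have v': "asd_weyl v = (- m) *\<^sub>R v"
    by (metis minus_minus scaleR_minus_left)
  have "- m = l1"
  proof (rule antisym)
    show "l1 \<le> - m" using eig[of "- m"] v(1) v' assms(1,2) by auto
    show "- m \<le> l1" using eig[of l1] m by fastforce
  qed
  then have "v \<bullet> asd_weyl v = l1" using v(1) v' by simp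
  then show "is_minimum (H_ohol_values G J x) (H_base + l1 / 2)"
    unfolding is_minimum_def H_ohol_values_eq using v m \<open>- m = l1\<close> by force
qed

end

theorem lemma2:
  fixes X :: "'m topology" and A :: "'m chart set"
    and g J :: "'m chart \<Rightarrow> real ^ 4 \<Rightarrow> real ^ 4 ^ 4"
    and c :: "'m chart" and p :: 'm and x :: "real ^ 4" and s s_star l1 l2 l3 :: real
  assumes "almost_hermitian_four_manifold X A g J"
    and "p \<in> topspace X" and "c \<in> A" and "p \<in> fst c"
    and "x = snd c p" and "s = scalar_curvature (g c) x"
    and "s_star = star_scalar_curvature (g c) (J c) x"
    and "l1 \<le> l2" and "l2 \<le> l3"
    and "eigenvalues_on (Lambda_minus (g c) (J c) x) (W_minus (g c) (J c) x) [l1, l2, l3]"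
  shows "is_maximum (H_ohol_values (g c) (J c) x) ((s + 3 * s_star) / 24 + l3 / 2) \<and>
         is_minimum (H_ohol_values (g c) (J c) x) ((s + 3 * s_star) / 24 + l1 / 2)"
proof -
  have M: "smooth_four_manifold X A" "riemannian_metric_on A g" "almost_complex_structure_on A J"
    "\<And>x u v. x \<in> chart_image c \<Longrightarrow> metric (g c) x (J c x *v u) (J c x *v v) = metric (g c) x u v"
    using assms(1,3) unfolding almost_hermitian_four_manifold_def by auto
  have x: "x \<in> chart_image c" using assms(4,5) by simp
  interpret c2_metric "g c" "chart_image c"
  proof
    show "open (chart_image c)"
      using M(1) assms(3) unfolding smooth_four_manifold_def by blast
    show "Ck_on 2 (g c) (chart_image c)"
      using M(2) assms(3) unfolding riemannian_metric_on_def smooth_on_def by blast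
    show "metric (g c) y u v = metric (g c) y v u" if "y \<in> chart_image c" for y u v
      using M(2) assms(3) that unfolding riemannian_metric_on_def by blast
    show "metric (g c) y v v > 0" if "y \<in> chart_image c" "v \<noteq> 0" for y v
      using M(2) assms(3) that unfolding riemannian_metric_on_def by blast
  qed
  have J: "J c x *v (J c x *v v) = - v" for v
    using M(3) assms(3) x unfolding almost_complex_structure_on_def by blast
  \<comment> \<open>Any adapted basis at the point will serve: the quantities in the conclusion do
    not mention the frame.\<close>
  obtain X Y where "orthonormal (g c) x [X, J c x *v X, Y, J c x *v Y]"
    using exists_adapted_basis[where J = "J c" and x = x, OF x J M(4)[OF x]] .
  then interpret adapted_frame "g c" "chart_image c" "J c" x
    "transpose (frame X (J c x *v X) Y (J c x *v Y))"
    by (rule adapted_frameI[where J = "J c" and x = x, OF x J])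
  show ?thesis
    using H_ohol_extrema[OF assms(8-10)] unfolding assms(6,7) by blast
qed

end
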